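(* Let $\mathcal X,\mathcal Y,\mathcal Z$ be arbitrary nonzero Banach spaces over $\mathbb F$, let $\mathcal M$ and $\mathcal N$ be nonzero (closed) subspaces of $\mathcal X$ and $\mathcal Y$, respectively, and consider the following assertions. (o) $\mathcal M$ and $\mathcal N$ are complemented in $\mathcal X$ and $\mathcal Y$ with $\mathcal M=\mathcal R(E)$ and $\mathcal N=\mathcal R(P)$ for projections $E\in\mathcal B[\mathcal X,\mathcal X]$ and $P\in\mathcal B[\mathcal Y,\mathcal Y]$ such that $\|E\|=\|P\|=1$. (a) $\mathcal M\otimes_\wedge\mathcal N$ is a linear manifold of $\mathcal X\otimes_\wedge\mathcal Y$. (b) Every bounded bilinear map $\phi:\mathcal M\times\mathcal N\to\mathcal Z$ has a bounded bilinear extension $\widehat\phi:\mathcal X\times\mathcal Y\to\mathcal Z$ with $\|\widehat\phi\|=\|\phi\|$. (c) Every bounded linear transformation $T:\mathcal M\otimes_\wedge\mathcal N\to\mathcal Z$ has a bounded linear extension $\widetilde T:\mathcal X\otimes_\wedge\mathcal Y\to\mathcal Z$ with $\|\widetilde T\|=\|T\|$. (d) Every bounded linear transformation $\overline T:\mathcal M\widehat\otimes_\wedge\mathcal N\to\mathcal Z$ has a bounded linear extension $\widehat T:\mathcal X\widehat\otimes_\wedge\mathcal Y\to\mathcal Z$ with $\|\widehat T\|=\|\overline T\|$. Then (o) implies that both (a) and (b) hold; and the following are equivalent: [(a) and (b) both hold], (c), (d).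
   Context: $\mathbb F$ is either the real or the complex field; all linear spaces are over the same $\mathbb F$. A linear manifold is a (not necessarily closed) linear subspace with the inherited norm; a subspace means a closed linear manifold. A subspace is complemented if it has a (closed) subspace as an algebraic complement. $\mathcal B[\mathcal X,\mathcal Y]$ is the normed space of bounded linear transformations $\mathcal X\to\mathcal Y$; $\mathcal R(T)$ is the range of $T$; a projection is an idempotent linear transformation. A bilinear map $\phi$ is bounded if $\|\phi\|=\sup_{x\ne0,\,y\ne0}\frac{\|\phi(x,y)\|}{\|x\|\,\|y\|}<\infty$. $\mathcal X\otimes\mathcal Y$ is the algebraic tensor product; $\mathcal X\otimes_\wedge\mathcal Y$ is $\mathcal X\otimes\mathcal Y$ equipped with the projective norm $\|F\|_\wedge=\inf\sum_i\|x_i\|\,\|y_i\|$, the infimum being over all finite representations $F=\sum_i x_i\otimes y_i$ with $x_i\in\mathcal X$, $y_i\in\mathcal Y$; $\mathcal X\widehat\otimes_\wedge\mathcal Y$ is its completion. The space $\mathcal M\otimes_\wedge\mathcal N$ is defined in the same way from $\mathcal M$ and $\mathcal N$ (the infimum being over representations with $x_i\in\mathcal M$, $y_i\in\mathcal N$), and $\mathcal M\widehat\otimes_\wedge\mathcal N$ is its completion. Algebraically $\mathcal M\otimes\mathcal N$ is a linear subspace of $\mathcal X\otimes\mathcal Y$ in the natural way. "$\mathcal M\otimes_\wedge\mathcal N$ is a linear manifold of $\mathcal X\otimes_\wedge\mathcal Y$" means that the norms agree: $\|F\|_{\mathcal X\otimes_\wedge\mathcal Y}=\|F\|_{\mathcal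 M\otimes_\wedge\mathcal N}$ for every $F\in\mathcal M\otimes\mathcal N$. Extensions: in (b), $\widehat\phi|_{\mathcal M\times\mathcal N}=\phi$; in (c), $\widetilde T$ agrees with $T$ on $\mathcal M\otimes\mathcal N$; in (d), $\widehat T\circ\iota=\overline T$, where $\iota:\mathcal M\widehat\otimes_\wedge\mathcal N\to\mathcal X\widehat\otimes_\wedge\mathcal Y$ is the canonical bounded linear map, i.e. the continuous extension of the inclusion $\mathcal M\otimes\mathcal N\subseteq\mathcal X\otimes\mathcal Y$. *)

theory Defs
  imports
    "HOL-Analysis.Analysis"
    "HOL-Library.Function_Algebras"
    "HOL-Library.Set_Algebras"
begin

section \<open>Banach spaces over the real or the complex field\<close>

text \<open>
  The scalar field is a normed field that is either \<open>\<real>\<close> itself or \<open>\<real> + \<real> j\<close> with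
  \<open>j\<^sup>2 = -1\<close> and the usual modulus.
\<close>

class real_or_complex = real_normed_field +
  assumes real_or_complex:
    "(\<forall>z. \<exists>a. z = a *\<^sub>R 1) \<or>
     (\<exists>j. j * j = -1 \<and>
        (\<forall>z. \<exists>a b. z = a *\<^sub>R 1 + b *\<^sub>R j \<and> norm z = sqrt (a\<^sup>2 + b\<^sup>2)))"

instance real :: real_or_complex
  by standard auto

instance complex :: real_or_complex
proof (standard, rule disjI2, intro exI conjI allI)
  show "\<i> * \<i> = (-1 :: complex)"
    by simp
  show "z = Re z *\<^sub>R 1 + Im z *\<^sub>R \<i>" for z
    by (simp add: complex_eq_iff)
  show "norm z = sqrt ((Re z)\<^sup>2 + (Im z)\<^sup>2)" for z
    by (simp add: cmod_def)
qed

text \<open>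
  A Banach space over the field \<open>'f\<close> is a Banach space of class \<open>banach\<close> (the underlying
  real space) with a scalar multiplication by \<open>'f\<close> that extends the real one.
\<close>

locale banach_space_over = vector_space scale
  for scale :: "'f::real_or_complex \<Rightarrow> 'v::banach \<Rightarrow> 'v" +
  assumes norm_scale: "norm (scale c v) = norm c * norm v"
    and scale_of_real: "scale (of_real r) v = r *\<^sub>R v"

lemma banach_space_over_scaleR: "banach_space_over (scaleR :: real \<Rightarrow> 'v::banach \<Rightarrow> 'v)"
  by standard (auto simp: algebra_simps)

lemma banach_space_over_complex: "banach_space_over ((*) :: complex \<Rightarrow> complex \<Rightarrow> complex)"
  by standard (auto simp: algebra_simps norm_mult scaleR_conv_of_real)

definition closed_subspace :: "('f::real_or_complex \<Rightarrow> 'v::banach \<Rightarrow> 'v) \<Rightarrow> 'v set \<Rightarrow> bool"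
  where "closed_subspace s M \<longleftrightarrow> module.subspace s M \<and> closed M"

definition complemented :: "('f::real_or_complex \<Rightarrow> 'v::banach \<Rightarrow> 'v) \<Rightarrow> 'v set \<Rightarrow> bool"
  where "complemented s M \<longleftrightarrow>
    closed_subspace s M \<and> (\<exists>K. closed_subspace s K \<and> M \<inter> K = {0} \<and> M + K = UNIV)"

definition bounded_projection :: "('f::real_or_complex \<Rightarrow> 'v::banach \<Rightarrow> 'v) \<Rightarrow> ('v \<Rightarrow> 'v) \<Rightarrow> bool"
  where "bounded_projection s E \<longleftrightarrow>
    Vector_Spaces.linear s s E \<and> bounded_linear E \<and> E \<circ> E = E"

section \<open>Linear and bilinear maps on carriers\<close>

text \<open>
  A linear or bilinear map on subspaces is represented by a function on the whole type of
  which only the values on those subspaces matter.  The type \<open>'a\<close> is only required to carry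
  an addition since the elements of a completion below are cosets.
\<close>

definition linear_map_on ::
  "'a::plus set \<Rightarrow> ('f \<Rightarrow> 'a \<Rightarrow> 'a) \<Rightarrow> ('f \<Rightarrow> 'z::plus \<Rightarrow> 'z) \<Rightarrow> ('a \<Rightarrow> 'z) \<Rightarrow> bool"
  where "linear_map_on S sA sZ T \<longleftrightarrow>
    (\<forall>x\<in>S. \<forall>y\<in>S. T (x + y) = T x + T y) \<and> (\<forall>c. \<forall>x\<in>S. T (sA c x) = sZ c (T x))"

text \<open>
  In the next two definitions \<open>p\<close> is the norm on \<open>S\<close>.  The operator norm is the supremum
  of \<open>\<parallel>T x\<parallel> / p x\<close>; as in \<open>onorm\<close>, the zero vector contributes \<open>0 / 0 = 0\<close>.
\<close>

definition bounded_linear_on ::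
  "'a::plus set \<Rightarrow> ('a \<Rightarrow> real) \<Rightarrow> ('f \<Rightarrow> 'a \<Rightarrow> 'a) \<Rightarrow> ('f \<Rightarrow> 'z::real_normed_vector \<Rightarrow> 'z) \<Rightarrow>
    ('a \<Rightarrow> 'z) \<Rightarrow> bool"
  where "bounded_linear_on S p sA sZ T \<longleftrightarrow>
    linear_map_on S sA sZ T \<and> (\<exists>K. \<forall>x\<in>S. norm (T x) \<le> K * p x)"

definition onorm_on :: "'a set \<Rightarrow> ('a \<Rightarrow> real) \<Rightarrow> ('a \<Rightarrow> 'z::real_normed_vector) \<Rightarrow> real"
  where "onorm_on S p T = (SUP x\<in>S. norm (T x) / p x)"

definition bilinear_on ::
  "'x::plus set \<Rightarrow> 'y::plus set \<Rightarrow> ('f \<Rightarrow> 'x \<Rightarrow> 'x) \<Rightarrow> ('f \<Rightarrow> 'y \<Rightarrow> 'y) \<Rightarrow>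
    ('f \<Rightarrow> 'z::plus \<Rightarrow> 'z) \<Rightarrow> ('x \<Rightarrow> 'y \<Rightarrow> 'z) \<Rightarrow> bool"
  where "bilinear_on M N sX sY sZ \<phi> \<longleftrightarrow>
    (\<forall>y\<in>N. linear_map_on M sX sZ (\<lambda>x. \<phi> x y)) \<and> (\<forall>x\<in>M. linear_map_on N sY sZ (\<phi> x))"

definition bounded_bilinear_on ::
  "'x::real_normed_vector set \<Rightarrow> 'y::real_normed_vector set \<Rightarrow> ('f \<Rightarrow> 'x \<Rightarrow> 'x) \<Rightarrow>
    ('f \<Rightarrow> 'y \<Rightarrow> 'y) \<Rightarrow> ('f \<Rightarrow> 'z::real_normed_vector \<Rightarrow> 'z) \<Rightarrow> ('x \<Rightarrow> 'y \<Rightarrow> 'z) \<Rightarrow> bool"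
  where "bounded_bilinear_on M N sX sY sZ \<phi> \<longleftrightarrow>
    bilinear_on M N sX sY sZ \<phi> \<and>
    (\<exists>K. \<forall>x\<in>M. \<forall>y\<in>N. norm (\<phi> x y) \<le> K * (norm x * norm y))"

definition bilinear_norm_on ::
  "'x::real_normed_vector set \<Rightarrow> 'y::real_normed_vector set \<Rightarrow>
    ('x \<Rightarrow> 'y \<Rightarrow> 'z::real_normed_vector) \<Rightarrow> real"
  where "bilinear_norm_on M N \<phi> =
    (SUP (x, y)\<in>(M - {0}) \<times> (N - {0}). norm (\<phi> x y) / (norm x * norm y))"

section \<open>Algebraic tensor product and projective norm\<close>

text \<open>
  The algebraic tensor product of \<open>X\<close> and \<open>Y\<close> is realised as a space of linear functionals
  on the space of bilinear forms on \<open>X \<times> Y\<close>, with \<open>x \<otimes> y\<close> the evaluation at \<open>(x, y)\<close>.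
  Functions that are not bilinear forms are sent to \<open>0\<close>.
\<close>

type_synonym ('f, 'x, 'y) tensor = "('x \<Rightarrow> 'y \<Rightarrow> 'f) \<Rightarrow> 'f"

definition tensor_scale :: "'f::times \<Rightarrow> ('f, 'x, 'y) tensor \<Rightarrow> ('f, 'x, 'y) tensor"
  where "tensor_scale c F = (\<lambda>B. c * F B)"

definition tensor ::
  "('f::field \<Rightarrow> 'x::ab_group_add \<Rightarrow> 'x) \<Rightarrow> ('f \<Rightarrow> 'y::ab_group_add \<Rightarrow> 'y) \<Rightarrow>
    'x \<Rightarrow> 'y \<Rightarrow> ('f, 'x, 'y) tensor"
  where "tensor sX sY x y = (\<lambda>B. if bilinear_on UNIV UNIV sX sY (*) B then B x y else 0)"

text \<open>
  \<open>M \<otimes> N\<close>, as a linear subspace of \<open>X \<otimes> Y\<close>; the latter is the case \<open>M = N = UNIV\<close>.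
  That this is the tensor product of \<open>M\<close> and \<open>N\<close> is the lemma \<open>tensor_universal\<close> below.
\<close>

definition tensor_space ::
  "('f::field \<Rightarrow> 'x::ab_group_add \<Rightarrow> 'x) \<Rightarrow> ('f \<Rightarrow> 'y::ab_group_add \<Rightarrow> 'y) \<Rightarrow>
    'x set \<Rightarrow> 'y set \<Rightarrow> ('f, 'x, 'y) tensor set"
  where "tensor_space sX sY M N =
    module.span tensor_scale {tensor sX sY x y | x y. x \<in> M \<and> y \<in> N}"

definition projective_norm ::
  "('f::field \<Rightarrow> 'x::real_normed_vector \<Rightarrow> 'x) \<Rightarrow> ('f \<Rightarrow> 'y::real_normed_vector \<Rightarrow> 'y) \<Rightarrow>
    'x set \<Rightarrow> 'y set \<Rightarrow> ('f, 'x, 'y) tensor \<Rightarrow> real"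
  where "projective_norm sX sY M N F =
    Inf {(\<Sum>i<n. norm (x i) * norm (y i)) | (n::nat) x y.
           (\<forall>i<n. x i \<in> M \<and> y i \<in> N) \<and> F = (\<Sum>i<n. tensor sX sY (x i) (y i))}"

lemma vector_space_tensor_scale:
  "vector_space (tensor_scale :: 'f::field \<Rightarrow> ('f, 'x, 'y) tensor \<Rightarrow> ('f, 'x, 'y) tensor)"
  by standard (auto simp: tensor_scale_def fun_eq_iff algebra_simps)

lemma bilinear_on_tensor:
  "bilinear_on UNIV UNIV sX sY tensor_scale (tensor sX sY)"
  by (auto simp: bilinear_on_def linear_map_on_def tensor_def tensor_scale_def fun_eq_iff)

lemma linear_map_on_UNIV:
  assumes "vector_space s1" and "vector_space s2"
  shows "linear_map_on UNIV s1 s2 T \<longleftrightarrow> Vector_Spaces.linear s1 s2 T"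
proof -
  interpret vector_space_pair s1 s2
    by (rule vector_space_pair.intro) fact+
  show ?thesis
    by (auto simp: linear_map_on_def Vector_Spaces.linear_iff assms)
qed

lemma tensor_universal:
  fixes sX :: "'f::field \<Rightarrow> 'x::ab_group_add \<Rightarrow> 'x"
    and sY :: "'f \<Rightarrow> 'y::ab_group_add \<Rightarrow> 'y"
    and sW :: "'f \<Rightarrow> 'w::ab_group_add \<Rightarrow> 'w"
  assumes X: "vector_space sX" and Y: "vector_space sY" and W: "vector_space sW"
    and M: "module.subspace sX M" and N: "module.subspace sY N"
    and \<phi>: "bilinear_on M N sX sY sW \<phi>"
  shows "\<exists>T. linear_map_on (tensor_space sX sY M N) tensor_scale sW T \<and>
             (\<forall>x\<in>M. \<forall>y\<in>N. T (tensor sX sY x y) = \<phi> x y)"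
proof -
  interpret X: vector_space sX by fact
  interpret Y: vector_space sY by fact
  interpret W: vector_space sW by fact
  interpret F: vector_space "(*) :: 'f \<Rightarrow> 'f \<Rightarrow> 'f"
    by standard (auto simp: algebra_simps)
  interpret XX: vector_space_pair sX sX ..
  interpret YY: vector_space_pair sY sY ..
  interpret WF: vector_space_pair sW "(*) :: 'f \<Rightarrow> 'f \<Rightarrow> 'f" ..
  interpret t: vector_space "tensor_scale :: 'f \<Rightarrow> ('f, 'x, 'y) tensor \<Rightarrow> _"
    by (rule vector_space_tensor_scale)
  obtain p where p: "range p \<subseteq> M" "Vector_Spaces.linear sX sX p" "\<And>x. x \<in> M \<Longrightarrow> p x = x"
    using XX.linear_exists_left_inverse_on[OF X.linear_id M] by auto
  obtain q where q: "range q \<subseteq> N" "Vector_Spaces.linear sY sY q" "\<And>y. y \<in> N \<Longrightarrow> q y = y"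
    using YY.linear_exists_left_inverse_on[OF Y.linear_id N] by auto
  define lin where "lin l \<longleftrightarrow> Vector_Spaces.linear sW ((*) :: 'f \<Rightarrow> 'f \<Rightarrow> 'f) l" for l
  define P where "P F w \<longleftrightarrow> (\<forall>l. lin l \<longrightarrow> l w = F (\<lambda>x y. l (\<phi> (p x) (q y))))" for F w
  have lin: "l (a + b) = l a + l b" "l (sW c a) = c * l a" if "lin l" for l a b c
    using that by (simp_all add: lin_def Vector_Spaces.linear_iff)
  have unique: "w = w'" if "P F w" "P F w'" for F w w'
  proof (rule ccontr)
    assume "w \<noteq> w'"
    then have "W.independent {w - w'}" by simp
    then obtain l where l: "lin l" "l (w - w') = 1"
      using WF.linear_independent_extend[of "{w - w'}" "\<lambda>_. 1"] by (auto simp: lin_def)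
    have "l w = l (w - w') + l w'"
      using lin(1)[OF l(1), of "w - w'" w'] by simp
    then show False
      using that l by (auto simp: P_def)
  qed
  have bil: "bilinear_on UNIV UNIV sX sY (*) (\<lambda>x y. l (\<phi> (p x) (q y)))" if "lin l" for l
    using \<phi> p(1,2) q(1,2)
    by (auto simp: bilinear_on_def linear_map_on_def Vector_Spaces.linear_iff Vector_Spaces.linear_iff
        lin[OF that] image_subset_iff)
  have gen: "P (tensor sX sY x y) (\<phi> x y)" if "x \<in> M" "y \<in> N" for x y
    using that by (auto simp: P_def tensor_def bil p(3) q(3))
  have add: "P (F + G) (v + w)" if "P F v" "P G w" for F G v w
    using that by (auto simp: P_def lin)
  have scale: "P (tensor_scale c F) (sW c v)" if "P F v" for c F v
    using that by (auto simp: P_def lin tensor_scale_def)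
  have ex: "\<exists>w. P F w" if "F \<in> tensor_space sX sY M N" for F
    using that unfolding tensor_space_def
  proof (induction rule: t.span_induct_alt)
    case base
    have "P 0 0"
      using lin(2)[of _ 0 0] by (auto simp: P_def)
    then show ?case by blast
  next
    case (step c x y)
    then show ?case
      using gen add scale by fast
  qed
  define T where "T F = (THE w. P F w)" for F
  have T_eq: "T F = w" if "P F w" for F w
    unfolding T_def using that unique by blast
  have T: "P F (T F)" if "F \<in> tensor_space sX sY M N" for F
    using ex[OF that] T_eq by blast
  show ?thesis
    unfolding linear_map_on_def
    by (rule exI[of _ T]) (auto intro!: T_eq add scale gen T)
qed

section \<open>Completion\<close>

text \<open>
  The completion of a space \<open>S\<close> with norm \<open>p\<close> is the set of Cauchy sequences in \<open>S\<close> modulo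
  null sequences.  Its elements are cosets, which are added by the addition of sets from
  \<open>HOL-Library.Set_Algebras\<close>; the type class element \<open>0\<close> of that theory is not the zero of
  the completion, which is \<open>null_seqs S p\<close>.
\<close>

definition cauchy_seqs :: "'a::ab_group_add set \<Rightarrow> ('a \<Rightarrow> real) \<Rightarrow> (nat \<Rightarrow> 'a) set"
  where "cauchy_seqs S p =
    {u. range u \<subseteq> S \<and> (\<forall>e>0. \<exists>k. \<forall>m\<ge>k. \<forall>n\<ge>k. p (u m - u n) < e)}"

definition null_seqs :: "'a::ab_group_add set \<Rightarrow> ('a \<Rightarrow> real) \<Rightarrow> (nat \<Rightarrow> 'a) set"
  where "null_seqs S p = {u. range u \<subseteq> S \<and> (\<lambda>n. p (u n)) \<longlonglongrightarrow> 0}"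

definition completion :: "'a::ab_group_add set \<Rightarrow> ('a \<Rightarrow> real) \<Rightarrow> (nat \<Rightarrow> 'a) set set"
  where "completion S p = (\<lambda>u. u +o null_seqs S p) ` cauchy_seqs S p"

text \<open>
  Adding \<open>null_seqs S p\<close> only matters for the scalar \<open>0\<close>, where the image is \<open>{0}\<close>.
\<close>

definition completion_scale ::
  "'a::ab_group_add set \<Rightarrow> ('a \<Rightarrow> real) \<Rightarrow> ('f \<Rightarrow> 'a \<Rightarrow> 'a) \<Rightarrow>
    'f \<Rightarrow> (nat \<Rightarrow> 'a) set \<Rightarrow> (nat \<Rightarrow> 'a) set"
  where "completion_scale S p s c A = (\<lambda>u n. s c (u n)) ` A + null_seqs S p"

definition completion_norm :: "('a \<Rightarrow> real) \<Rightarrow> (nat \<Rightarrow> 'a) set \<Rightarrow> real"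
  where "completion_norm p A = (THE l. \<forall>u\<in>A. (\<lambda>n. p (u n)) \<longlonglongrightarrow> l)"

text \<open>
  If \<open>S' \<subseteq> S\<close> and the inclusion is bounded from the norm of \<open>S'\<close> to the norm \<open>p\<close> of \<open>S\<close>,
  then the null sequences of \<open>S'\<close> are null sequences of \<open>S\<close> and the continuous extension of
  the inclusion to the completions maps the class of \<open>u\<close> in the completion of \<open>S'\<close> to its
  class in the completion of \<open>S\<close>.
\<close>

definition completion_inclusion ::
  "'a::ab_group_add set \<Rightarrow> ('a \<Rightarrow> real) \<Rightarrow> (nat \<Rightarrow> 'a) set \<Rightarrow> (nat \<Rightarrow> 'a) set"
  where "completion_inclusion S p A = A + null_seqs S p"

section \<open>The assertions\<close>

definition assertion_o ::
  "('f::real_or_complex \<Rightarrow> 'x::banach \<Rightarrow> 'x) \<Rightarrow> ('f \<Rightarrow> 'y::banach \<Rightarrow> 'y) \<Rightarrow>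
    'x set \<Rightarrow> 'y set \<Rightarrow> bool"
  where "assertion_o sX sY M N \<longleftrightarrow>
    complemented sX M \<and> complemented sY N \<and>
    (\<exists>E P. bounded_projection sX E \<and> bounded_projection sY P \<and>
       M = range E \<and> N = range P \<and> onorm E = 1 \<and> onorm P = 1)"

definition assertion_a ::
  "('f::real_or_complex \<Rightarrow> 'x::banach \<Rightarrow> 'x) \<Rightarrow> ('f \<Rightarrow> 'y::banach \<Rightarrow> 'y) \<Rightarrow>
    'x set \<Rightarrow> 'y set \<Rightarrow> bool"
  where "assertion_a sX sY M N \<longleftrightarrow>
    (\<forall>F\<in>tensor_space sX sY M N.
       projective_norm sX sY UNIV UNIV F = projective_norm sX sY M N F)"

definition assertion_b ::
  "('f::real_or_complex \<Rightarrow> 'x::banach \<Rightarrow> 'x) \<Rightarrow> ('f \<Rightarrow> 'y::banach \<Rightarrow> 'y) \<Rightarrow>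
    ('f \<Rightarrow> 'z::banach \<Rightarrow> 'z) \<Rightarrow> 'x set \<Rightarrow> 'y set \<Rightarrow> bool"
  where "assertion_b sX sY sZ M N \<longleftrightarrow>
    (\<forall>\<phi>. bounded_bilinear_on M N sX sY sZ \<phi> \<longrightarrow>
       (\<exists>\<phi>'. bounded_bilinear_on UNIV UNIV sX sY sZ \<phi>' \<and>
          (\<forall>x\<in>M. \<forall>y\<in>N. \<phi>' x y = \<phi> x y) \<and>
          bilinear_norm_on UNIV UNIV \<phi>' = bilinear_norm_on M N \<phi>))"

definition assertion_c ::
  "('f::real_or_complex \<Rightarrow> 'x::banach \<Rightarrow> 'x) \<Rightarrow> ('f \<Rightarrow> 'y::banach \<Rightarrow> 'y) \<Rightarrow>
    ('f \<Rightarrow> 'z::banach \<Rightarrow> 'z) \<Rightarrow> 'x set \<Rightarrow> 'y set \<Rightarrow> bool"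
  where "assertion_c sX sY sZ M N \<longleftrightarrow>
    (let XY = tensor_space sX sY UNIV UNIV; p = projective_norm sX sY UNIV UNIV;
         MN = tensor_space sX sY M N; q = projective_norm sX sY M N
     in \<forall>T. bounded_linear_on MN q tensor_scale sZ T \<longrightarrow>
          (\<exists>T'. bounded_linear_on XY p tensor_scale sZ T' \<and>
             (\<forall>F\<in>MN. T' F = T F) \<and> onorm_on XY p T' = onorm_on MN q T))"

definition assertion_d ::
  "('f::real_or_complex \<Rightarrow> 'x::banach \<Rightarrow> 'x) \<Rightarrow> ('f \<Rightarrow> 'y::banach \<Rightarrow> 'y) \<Rightarrow>
    ('f \<Rightarrow> 'z::banach \<Rightarrow> 'z) \<Rightarrow> 'x set \<Rightarrow> 'y set \<Rightarrow> bool"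
  where "assertion_d sX sY sZ M N \<longleftrightarrow>
    (let XY = tensor_space sX sY UNIV UNIV; p = projective_norm sX sY UNIV UNIV;
         MN = tensor_space sX sY M N; q = projective_norm sX sY M N
     in \<forall>T. bounded_linear_on (completion MN q) (completion_norm q)
              (completion_scale MN q tensor_scale) sZ T \<longrightarrow>
          (\<exists>T'. bounded_linear_on (completion XY p) (completion_norm p)
                  (completion_scale XY p tensor_scale) sZ T' \<and>
             (\<forall>A\<in>completion MN q. T' (completion_inclusion XY p A) = T A) \<and>
             onorm_on (completion XY p) (completion_norm p) T' =
             onorm_on (completion MN q) (completion_norm q) T))"

end

theory Submission
  imports Defs
begin

text \<open>
  The heart of the matter is the correspondence between bounded bilinear maps on \<open>M \<times> N\<close> and
  bounded linear maps on \<open>M \<otimes> N\<close> with the projective norm, which preserves norms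
  (\<open>bounded_linear_on_tensor_space_iff\<close>).  Applied to \<open>M \<times> N\<close> and to \<open>X \<times> Y\<close>, it turns an extension
  of one kind into an extension of the other, so that (b) and (c) are equivalent.

  Assertion (c) also implies (a).  Given \<open>G\<close> in \<open>M \<otimes> N\<close>, the Hahn-Banach theorem provides a
  functional \<open>f\<close> of norm at most one on \<open>M \<otimes> N\<close> that attains \<open>\<parallel>G\<parallel>\<close> at \<open>G\<close> (\<open>norming_functional\<close>).  The
  operator \<open>F \<mapsto> f F z\<close> with a unit vector \<open>z\<close> is extended to \<open>X \<otimes> Y\<close> with the same norm, and its value
  at \<open>G\<close> shows that the norm of \<open>G\<close> in \<open>X \<otimes> Y\<close> is not smaller than the one in \<open>M \<otimes> N\<close>; the opposite
  inequality is clear.  Hence (c) is equivalent to the conjunction of (a) and (b).  Moreover,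
  (o) implies (b) by composing bilinear maps with the two projections, and (a) then follows
  through (c).

  The equivalence of (c) and (d) has nothing to do with tensors: an operator into a Banach space
  extends uniquely to the completion with the same norm
  (\<open>bounded_extension_completion_iff\<close>).
\<close>

section \<open>Norming functionals\<close>

definition sublinear :: "(real \<Rightarrow> 'v::ab_group_add \<Rightarrow> 'v) \<Rightarrow> ('v \<Rightarrow> real) \<Rightarrow> bool"
  where "sublinear s r \<longleftrightarrow>
    (\<forall>x y. r (x + y) \<le> r x + r y) \<and> (\<forall>t\<ge>0. \<forall>x. r (s t x) = t * r x)"

text \<open>
  For sublinear \<open>r\<close> this is the largest sublinear functional below \<open>r\<close> whose value at \<open>- a\<close> is at most
  \<open>- r a\<close>.  A linear functional below it therefore takes the value \<open>r a\<close> at \<open>a\<close>.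
\<close>
definition tilt :: "(real \<Rightarrow> 'v::ab_group_add \<Rightarrow> 'v) \<Rightarrow> ('v \<Rightarrow> real) \<Rightarrow> 'v \<Rightarrow> 'v \<Rightarrow> real"
  where "tilt s r a x = (INF t\<in>{0..}. r (x + s t a) - t * r a)"

context
  fixes s :: "real \<Rightarrow> 'v::ab_group_add \<Rightarrow> 'v"
  assumes s: "vector_space s"
begin

interpretation vector_space s by (fact s)

lemma sublinear_minus_le:
  assumes "sublinear s r"
  shows "- r (- x) \<le> r x"
proof -
  have "r 0 = 0"
    using assms unfolding sublinear_def by (metis mult_zero_left order_refl scale_zero_left)
  moreover have "r (x + - x) \<le> r x + r (- x)"
    using assms unfolding sublinear_def by blast
  ultimately show ?thesis by simp
qed

text \<open>
  The infimum of a chain is finite at \<open>x\<close> because \<open>- q (- x)\<close> is a common lower bound.  It is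
  subadditive because two members of a chain are comparable, so that the smaller one can be
  used at both arguments.
\<close>
lemma sublinear_INF:
  assumes sub: "\<And>r. r \<in> C \<Longrightarrow> sublinear s r" and le: "\<And>r. r \<in> C \<Longrightarrow> r \<le> q"
    and chain: "\<And>r r'. r \<in> C \<Longrightarrow> r' \<in> C \<Longrightarrow> r \<le> r' \<or> r' \<le> r" and ne: "C \<noteq> {}"
  shows "sublinear s (\<lambda>x. INF r\<in>C. r x)" and "\<And>r x. r \<in> C \<Longrightarrow> (INF r\<in>C. r x) \<le> r x"
proof -
  have bdd: "bdd_below ((\<lambda>r. r x) ` C)" for x
  proof (rule bdd_belowI2[where m = "- q (- x)"])
    fix r assume "r \<in> C"
    then show "- q (- x) \<le> r x"
      using sublinear_minus_le[OF sub, of r x] le_funD[OF le, of r "- x"] by simp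
  qed
  show low: "(INF r\<in>C. r x) \<le> r x" if "r \<in> C" for r x
    using bdd that by (rule cINF_lower)
  have add: "(INF r\<in>C. r (x + y)) \<le> (INF r\<in>C. r x) + (INF r\<in>C. r y)" for x y
  proof -
    have *: "(INF r\<in>C. r (x + y)) \<le> r x + r' y" if r: "r \<in> C" "r' \<in> C" for r r'
    proof -
      obtain r'' where r'': "r'' \<in> C" "r'' \<le> r" "r'' \<le> r'"
        using chain[OF r] r by blast
      have "(INF r\<in>C. r (x + y)) \<le> r'' (x + y)"
        using low r'' by blast
      also have "\<dots> \<le> r'' x + r'' y"
        using sub[OF r''(1)] by (simp add: sublinear_def)
      also have "\<dots> \<le> r x + r' y"
        using r'' by (auto simp: le_fun_def intro: add_mono)
      finally show ?thesis .
    qed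
    have "(INF r\<in>C. r (x + y)) - r x \<le> (INF r\<in>C. r y)" if "r \<in> C" for r
      using *[OF that] ne by (intro cINF_greatest) (auto simp: diff_le_eq add.commute)
    then have "(INF r\<in>C. r (x + y)) - (INF r\<in>C. r y) \<le> (INF r\<in>C. r x)"
      using ne by (intro cINF_greatest) (auto simp: diff_le_eq add.commute)
    then show ?thesis by simp
  qed
  have le_scale: "t * (INF r\<in>C. r x) \<le> (INF r\<in>C. r (s t x))" if "t \<ge> 0" for t x
  proof (rule cINF_greatest[OF ne])
    fix r assume "r \<in> C"
    then show "t * (INF r\<in>C. r x) \<le> r (s t x)"
      using mult_left_mono[OF low that] sub that by (simp add: sublinear_def)
  qed
  have scale: "(INF r\<in>C. r (s t x)) = t * (INF r\<in>C. r x)" if t: "t \<ge> 0" for t x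
  proof (cases "t = 0")
    case True
    then have "(\<lambda>r. r (s t x)) ` C = {0}"
      using ne sub t by (force simp: sublinear_def)
    then have "(INF r\<in>C. r (s t x)) = Inf {0}"
      by simp
    then show ?thesis
      using True by simp
  next
    case False
    then have "inverse t * (INF r\<in>C. r (s t x)) \<le> (INF r\<in>C. r x)"
      using le_scale[of "inverse t" "s t x"] t by simp
    then have "(INF r\<in>C. r (s t x)) \<le> t * (INF r\<in>C. r x)"
      using False t by (simp add: field_simps)
    then show ?thesis
      using le_scale[OF t] by (meson antisym)
  qed
  show "sublinear s (\<lambda>x. INF r\<in>C. r x)"
    using add scale by (simp add: sublinear_def)
qed

lemma tilt:
  assumes r: "sublinear s r"
  shows sublinear_tilt: "sublinear s (tilt s r a)"
    and tilt_le: "t \<ge> 0 \<Longrightarrow> tilt s r a x \<le> r (x + s t a) - t * r a"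
proof -
  have r_add: "r (x + y) \<le> r x + r y" and r_scale: "t \<ge> 0 \<Longrightarrow> r (s t x) = t * r x" for x y t
    using r by (auto simp: sublinear_def)
  have low: "tilt s r a x \<le> r (x + s t a) - t * r a" if "t \<ge> 0" for x t
    unfolding tilt_def
  proof (rule cINF_lower)
    show "bdd_below ((\<lambda>t. r (x + s t a) - t * r a) ` {0..})"
    proof (rule bdd_belowI2[where m = "- r (- x)"])
      fix t :: real assume "t \<in> {0..}"
      then show "- r (- x) \<le> r (x + s t a) - t * r a"
        using r_add[of "- x" "x + s t a"] r_scale[of t a] by simp
    qed
  qed (use that in simp)
  then show "t \<ge> 0 \<Longrightarrow> tilt s r a x \<le> r (x + s t a) - t * r a" .
  have add: "tilt s r a (x + y) \<le> tilt s r a x + tilt s r a y" for x y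
  proof -
    have *: "tilt s r a (x + y) \<le> (r (x + s t a) - t * r a) + (r (y + s u a) - u * r a)"
      if "t \<ge> 0" "u \<ge> 0" for t u
      using low[of "t + u" "x + y"] r_add[of "x + s t a" "y + s u a"] that
      by (simp add: algebra_simps)
    have "tilt s r a (x + y) - (r (x + s t a) - t * r a) \<le> tilt s r a y" if "t \<ge> 0" for t
      unfolding tilt_def[of s r a y]
      using *[OF that] by (intro cINF_greatest) (auto simp: algebra_simps)
    then have "tilt s r a (x + y) - tilt s r a y \<le> tilt s r a x"
      unfolding tilt_def[of s r a x] by (intro cINF_greatest) (auto simp: algebra_simps)
    then show ?thesis by simp
  qed
  have le_scale: "t * tilt s r a x \<le> tilt s r a (s t x)" if t: "t > 0" for t x
    unfolding tilt_def[of s r a "s t x"]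
  proof (rule cINF_greatest)
    fix u :: real assume u: "u \<in> {0..}"
    have "s t x + s u a = s t (x + s (u / t) a)"
      using t by (simp add: scale_right_distrib)
    then have "r (s t x + s u a) = t * r (x + s (u / t) a)"
      using r_scale[of t "x + s (u / t) a"] t by (metis less_imp_le)
    then have "r (s t x + s u a) - u * r a = t * (r (x + s (u / t) a) - (u / t) * r a)"
      using t by (simp add: right_diff_distrib)
    then show "t * tilt s r a x \<le> r (s t x + s u a) - u * r a"
      using low[of "u / t" x] t u by simp
  qed simp
  have scale: "tilt s r a (s t x) = t * tilt s r a x" if t: "t \<ge> 0" for t x
  proof (cases "t = 0")
    case True
    have "tilt s r a 0 = 0"
      unfolding tilt_def using r_scale by (simp add: image_constant_conv)
    with True show ?thesis by simp
  next
    case False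
    then have "inverse t * tilt s r a (s t x) \<le> tilt s r a x"
      using le_scale[of "inverse t" "s t x"] t by simp
    then have "tilt s r a (s t x) \<le> t * tilt s r a x"
      using False t by (simp add: field_simps)
    then show ?thesis
      using le_scale[of t x] False t by (simp add: antisym)
  qed
  show "sublinear s (tilt s r a)"
    using add scale by (simp add: sublinear_def)
qed

text \<open>
  A minimal sublinear functional \<open>r\<close> equals its tilt in every direction \<open>y\<close>, and the term
  \<open>t = 1\<close> of the infimum that defines the tilt gives \<open>r x \<le> r (x + y) - r y\<close>.
\<close>
lemma minimal_sublinear_additive:
  assumes r: "sublinear s r" and min: "\<And>r'. sublinear s r' \<Longrightarrow> r' \<le> r \<Longrightarrow> r' = r"
  shows "r (x + y) = r x + r y"
proof -
  have "tilt s r y \<le> r"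
    using tilt_le[OF r, of 0 y] by (simp add: le_fun_def)
  then have "tilt s r y = r"
    using min sublinear_tilt[OF r] by blast
  then have "r x \<le> r (x + y) - r y"
    using tilt_le[OF r, of 1 y x] by simp
  moreover have "r (x + y) \<le> r x + r y"
    using r by (simp add: sublinear_def)
  ultimately show ?thesis by simp
qed

text \<open>
  The Hahn-Banach theorem, without extension from subspaces one dimension at a time: below every
  sublinear functional there is a minimal one by Zorn's lemma, and minimal sublinear functionals
  are linear.  Starting below the tilt of \<open>q\<close> at \<open>a\<close> prescribes the value at \<open>a\<close>.
\<close>
lemma sublinear_dominates_linear:
  assumes q: "sublinear s q"
  obtains f where "Vector_Spaces.linear s (*) f" "f \<le> q" "f a = q a"
proof -
  let ?q = "tilt s q a"
  let ?A = "{r. sublinear s r \<and> r \<le> ?q}"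
  have "\<exists>m\<in>?A. \<forall>r\<in>?A. m \<ge> r \<longrightarrow> r = m"
  proof (rule predicate_Zorn)
    show "partial_order_on ?A (relation_of (\<ge>) ?A)"
      by (rule partial_order_on_relation_ofI) auto
    fix C assume "C \<in> Chains (relation_of (\<ge>) ?A)"
    then have C: "C \<subseteq> ?A" "\<And>r r'. r \<in> C \<Longrightarrow> r' \<in> C \<Longrightarrow> r \<le> r' \<or> r' \<le> r"
      by (auto simp: Chains_def relation_of_def)
    show "\<exists>u\<in>?A. \<forall>r\<in>C. u \<le> r"
    proof (cases "C = {}")
      case True
      then show ?thesis
        using sublinear_tilt[OF q] by blast
    next
      case False
      then obtain r where r: "r \<in> C" by blast
      have sub: "sublinear s (\<lambda>x. INF r\<in>C. r x)"
        and low: "\<And>r x. r \<in> C \<Longrightarrow> (INF r\<in>C. r x) \<le> r x"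
        using sublinear_INF[of C ?q] C False by blast+
      have "(\<lambda>x. INF r\<in>C. r x) \<le> ?q"
        using low[OF r] C(1) r by (force simp: le_fun_def intro: order_trans)
      then show ?thesis
        using sub low by (intro bexI[of _ "\<lambda>x. INF r\<in>C. r x"]) (auto simp: le_fun_def)
    qed
  qed
  then obtain f where f: "sublinear s f" "f \<le> ?q"
    and min: "\<And>r. sublinear s r \<Longrightarrow> r \<le> ?q \<Longrightarrow> r \<le> f \<Longrightarrow> r = f"
    by blast
  have add: "f (x + y) = f x + f y" for x y
    using minimal_sublinear_additive[OF f(1)] min f(2) order_trans by blast
  then have minus: "f (- x) = - f x" for x
    by (metis add.right_inverse add_cancel_left_left eq_neg_iff_add_eq_0 add.commute)
  have "f (s t x) = t * f x" for t x
  proof (cases "t \<ge> 0")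
    case True
    then show ?thesis using f(1) by (simp add: sublinear_def)
  next
    case False
    then have "0 \<le> - t" by simp
    then have "f (s (- t) x) = - t * f x"
      using f(1) unfolding sublinear_def by blast
    then show ?thesis by (simp add: minus)
  qed
  moreover have "vector_space ((*) :: real \<Rightarrow> real \<Rightarrow> real)"
    by standard (auto simp: algebra_simps)
  ultimately have lin: "Vector_Spaces.linear s (*) f"
    by (auto simp: Vector_Spaces.linear_iff add s)
  have le: "f \<le> q"
    using order_trans[OF le_funD[OF f(2)] tilt_le[OF q, of 0 a]] by (simp add: le_fun_def)
  have "q 0 = 0"
    using q unfolding sublinear_def by (metis mult_zero_left order_refl scale_zero_left)
  then have "f (- a) \<le> - q a"
    using order_trans[OF le_funD[OF f(2)] tilt_le[OF q, of 1 a "- a"]] by simp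
  then have "f a = q a"
    using le by (simp add: minus le_fun_def antisym)
  with lin le show thesis by (rule that)
qed

end

text \<open>
  This is all that has to be known about the scalar field: it has a real part, and every
  real-linear functional \<open>g\<close> is the real part of a functional that is linear over the field.
  That functional is \<open>g\<close> itself over the reals and \<open>x \<mapsto> g x - g (j x) j\<close> when \<open>j\<^sup>2 = -1\<close>.
\<close>
lemma linear_map_with_real_part:
  fixes s :: "'f::real_or_complex \<Rightarrow> 'v::ab_group_add \<Rightarrow> 'v"
  assumes s: "vector_space s"
  obtains R :: "'f \<Rightarrow> real" where "\<And>z. R z \<le> norm z" "\<And>a. R (of_real a) = a"
    "\<And>g. Vector_Spaces.linear (\<lambda>t. s (of_real t)) (*) g \<Longrightarrow>
      \<exists>f. linear_map_on UNIV s (*) f \<and> (\<forall>x. R (f x) = g x)"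
proof -
  interpret vector_space s by fact
  have g_add: "g (x + y) = g x + g y" and g_scale: "g (s (of_real t) x) = t * g x"
    if "Vector_Spaces.linear (\<lambda>t. s (of_real t)) (*) g" for g x y and t :: real
    using that by (auto simp: Vector_Spaces.linear_iff)
  consider "\<forall>z::'f. \<exists>a. z = of_real a"
    | j :: 'f where "j * j = -1"
      "\<And>z. \<exists>a b. z = of_real a + of_real b * j \<and> norm z = sqrt (a\<^sup>2 + b\<^sup>2)"
    using real_or_complex[where 'a = 'f] by (auto simp: scaleR_conv_of_real)
  then show thesis
  proof cases
    case 1
    define R :: "'f \<Rightarrow> real" where "R z = (THE a. z = of_real a)" for z
    have R: "R (of_real a) = a" for a
      by (simp add: R_def)
    show thesis
    proof (rule that[of R])
      show "R z \<le> norm z" for z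
        using 1 R by (metis abs_ge_self norm_of_real)
      fix g assume g: "Vector_Spaces.linear (\<lambda>t. s (of_real t)) (*) g"
      have "linear_map_on UNIV s (*) (\<lambda>x. of_real (g x))"
        unfolding linear_map_on_def
        by (auto simp: g_add[OF g]) (metis 1 g_scale[OF g] of_real_mult)
      then show "\<exists>f. linear_map_on UNIV s (*) f \<and> (\<forall>x. R (f x) = g x)"
        using R by blast
    qed (rule R)
  next
    case (2 j)
    \<comment> \<open>\<open>1\<close> and \<open>j\<close> are independent over the reals, as a real \<open>j\<close> would have a square \<open>\<ge> 0\<close>.\<close>
    have zero: "a = 0 \<and> b = 0" if "of_real a + of_real b * j = 0" for a b
    proof -
      have "b = 0"
      proof (rule ccontr)
        assume "b \<noteq> 0"
        then have "j = of_real (- a / b)"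
          using that by (simp add: field_simps eq_neg_iff_add_eq_0)
        then have "of_real ((- a / b) * (- a / b)) = (of_real (-1) :: 'f)"
          using 2(1) by (metis of_real_1 of_real_minus of_real_mult)
        then have "(- a / b) * (- a / b) = -1"
          by (simp only: of_real_eq_iff)
        then show False
          by (metis not_one_le_zero zero_le_square neg_0_le_iff_le)
      qed
      then show ?thesis using that by simp
    qed
    have unique: "a = a' \<and> b = b'"
      if "of_real a + of_real b * j = of_real a' + of_real b' * j" for a b a' b'
      using zero[of "a - a'" "b - b'"] that by (simp add: algebra_simps)
    define R :: "'f \<Rightarrow> real" where "R z = (THE a. \<exists>b. z = of_real a + of_real b * j)" for z
    have R: "R (of_real a + of_real b * j) = a" for a b
      unfolding R_def using unique by blast
    show thesis
    proof (rule that[of R])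
      show "R (of_real a) = a" for a
        using R[of a 0] by simp
      show "R z \<le> norm z" for z
      proof -
        obtain a b where "z = of_real a + of_real b * j" "norm z = sqrt (a\<^sup>2 + b\<^sup>2)"
          using 2(2) by blast
        then show ?thesis
          using R by simp
      qed
      fix g assume g: "Vector_Spaces.linear (\<lambda>t. s (of_real t)) (*) g"
      let ?f = "\<lambda>x. of_real (g x) + of_real (- g (s j x)) * j"
      have add: "?f (x + y) = ?f x + ?f y" for x y
        by (simp add: g_add[OF g] scale_right_distrib algebra_simps)
      have real: "?f (s (of_real t) x) = of_real t * ?f x" for t x
        using g_scale[OF g, of t "s j x"]
        by (simp add: g_scale[OF g] scale_left_commute algebra_simps)
      have gm: "g (- x) = - g x" for x
        using g_scale[OF g, of "- 1" x] by simp
      have j: "?f (s j x) = j * ?f x" for x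
      proof -
        have "?f (s j x) = of_real (g (s j x)) + of_real (g x) * j"
          by (simp add: 2(1) gm)
        also have "\<dots> = j * of_real (g x) + of_real (- g (s j x)) * (j * j)"
          by (simp add: 2(1))
        finally show ?thesis
          by (simp add: algebra_simps)
      qed
      have "?f (s c x) = c * ?f x" for c x
      proof -
        obtain a b where c: "c = of_real a + of_real b * j"
          using 2(2) by blast
        have "?f (s c x) = ?f (s (of_real a) x + s (of_real b) (s j x))"
          by (simp add: c scale_left_distrib)
        also have "\<dots> = c * ?f x"
          unfolding add real j c by (simp only: distrib_right mult.assoc)
        finally show ?thesis .
      qed
      then have "linear_map_on UNIV s (*) ?f"
        using add unfolding linear_map_on_def by blast
      then show "\<exists>f. linear_map_on UNIV s (*) f \<and> (\<forall>x. R (f x) = g x)"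
        using R by blast
    qed
  qed
qed

text \<open>
  The conditions concern \<open>S\<close> only, since \<open>M \<otimes> N\<close> and \<open>X \<otimes> Y\<close> are subspaces of the same type,
  each with a norm of its own.
\<close>
locale seminormed_space = vector_space s
  for s :: "'f::real_or_complex \<Rightarrow> 'v::ab_group_add \<Rightarrow> 'v" +
  fixes S :: "'v set" and q :: "'v \<Rightarrow> real"
  assumes subspace: "subspace S"
    and nonneg: "x \<in> S \<Longrightarrow> 0 \<le> q x"
    and triangle: "x \<in> S \<Longrightarrow> y \<in> S \<Longrightarrow> q (x + y) \<le> q x + q y"
    and homogeneous: "x \<in> S \<Longrightarrow> q (s c x) = norm c * q x"

text \<open>
  Functions are total and \<open>q\<close> is a seminorm on \<open>S\<close> only.  Composition with a linear projection
  onto \<open>S\<close> turns \<open>q\<close> into a seminorm on the whole type.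
\<close>
lemma norming_functional:
  fixes s :: "'f::real_or_complex \<Rightarrow> 'v::ab_group_add \<Rightarrow> 'v"
  assumes "seminormed_space s S q" and a: "a \<in> S"
  obtains f where "linear_map_on S s (*) f" "\<And>x. x \<in> S \<Longrightarrow> norm (f x) \<le> q x" "norm (f a) = q a"
proof -
  interpret seminormed_space s S q by fact
  interpret vector_space_pair s s ..
  obtain \<pi> where \<pi>: "range \<pi> \<subseteq> S" "Vector_Spaces.linear s s \<pi>" "\<And>x. x \<in> S \<Longrightarrow> \<pi> x = x"
    using linear_exists_left_inverse_on[OF linear_id subspace] by auto
  define p where "p x = q (\<pi> x)" for x
  have \<pi>S: "\<pi> x \<in> S" for x
    using \<pi>(1) by blast
  have p_add: "p (x + y) \<le> p x + p y" and p_scale: "p (s c x) = norm c * p x" for x y c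
    using triangle[OF \<pi>S \<pi>S] homogeneous[OF \<pi>S] \<pi>(2)
    by (simp_all add: p_def Vector_Spaces.linear_iff)
  have real: "vector_space (\<lambda>t. s (of_real t))"
    by standard (auto simp: algebra_simps)
  have "sublinear (\<lambda>t. s (of_real t)) p"
    by (simp add: sublinear_def p_add p_scale)
  then obtain g where g: "Vector_Spaces.linear (\<lambda>t. s (of_real t)) (*) g" "g \<le> p" "g a = p a"
    using sublinear_dominates_linear[OF real] by blast
  obtain R :: "'f \<Rightarrow> real" where R: "\<And>z. R z \<le> norm z" "\<And>a. R (of_real a) = a"
    and ex: "\<And>g. Vector_Spaces.linear (\<lambda>t. s (of_real t)) (*) g \<Longrightarrow>
      \<exists>f. linear_map_on UNIV s (*) f \<and> (\<forall>x. R (f x) = g x)"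
    using linear_map_with_real_part[OF vector_space_axioms] by blast
  obtain f where f: "linear_map_on UNIV s (*) f" "\<And>x. R (f x) = g x"
    using ex[OF g(1)] by blast
  have le: "norm (f x) \<le> p x" for x
  proof (cases "f x = 0")
    case True
    then show ?thesis
      using nonneg[OF \<pi>S] by (simp add: p_def)
  next
    case False
    \<comment> \<open>Rotate \<open>x\<close> so that the value of \<open>f\<close> becomes its own real part.\<close>
    define c where "c = of_real (norm (f x)) / f x"
    have c: "norm c = 1" "c * f x = of_real (norm (f x))"
      using False by (simp_all add: c_def norm_divide)
    have "norm (f x) = R (f (s c x))"
      using f(1) by (simp add: linear_map_on_def c R)
    also have "\<dots> \<le> p (s c x)"
      using g(2) by (simp add: f(2) le_fun_def)
    finally show ?thesis
      by (simp add: p_scale c)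
  qed
  show thesis
  proof (rule that[of f])
    show "linear_map_on S s (*) f"
      using f(1) by (simp add: linear_map_on_def)
    show "norm (f x) \<le> q x" if "x \<in> S" for x
      using le[of x] that by (simp add: p_def \<pi>(3))
    then show "norm (f a) = q a"
      using R(1)[of "f a"] f(2)[of a] g(3) a by (simp add: p_def \<pi>(3) antisym)
  qed
qed

section \<open>Operator norms\<close>

text \<open>
  Reformulates the supremum, in which a vector with \<open>p x = 0\<close> contributes \<open>0\<close>, as a best constant.
  The two notions agree only because the assumed bound forces \<open>T x = 0\<close> at such vectors; and
  \<open>0 \<le> K\<close> has to be stated on the right since \<open>p\<close> may vanish identically.  All equalities of
  norms below are obtained by comparing best constants.
\<close>
lemma onorm_on_le_iff:
  assumes "S \<noteq> {}" and p: "\<And>x. x \<in> S \<Longrightarrow> 0 \<le> p x"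
    and bdd: "\<exists>K. \<forall>x\<in>S. norm (T x) \<le> K * p x"
  shows "onorm_on S p T \<le> K \<longleftrightarrow> 0 \<le> K \<and> (\<forall>x\<in>S. norm (T x) \<le> K * p x)"
proof -
  obtain L where L: "\<And>x. x \<in> S \<Longrightarrow> norm (T x) \<le> L * p x"
    using bdd by blast
  have "norm (T x) / p x \<le> max L 0" if "x \<in> S" for x
  proof (cases "p x = 0")
    case False
    then have "norm (T x) / p x \<le> L"
      using L[OF that] p[OF that] by (simp add: pos_divide_le_eq)
    then show ?thesis by simp
  qed simp
  then have bdd: "bdd_above ((\<lambda>x. norm (T x) / p x) ` S)"
    by (rule bdd_aboveI2)
  have le: "norm (T x) / p x \<le> K \<and> 0 \<le> K \<longleftrightarrow> norm (T x) \<le> K * p x \<and> 0 \<le> K" if "x \<in> S" for x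
    using L[OF that] p[OF that] by (cases "p x = 0") (auto simp: divide_simps)
  have "0 \<le> K" if "\<forall>x\<in>S. norm (T x) / p x \<le> K"
  proof -
    obtain x where x: "x \<in> S" using \<open>S \<noteq> {}\<close> by blast
    then have "0 \<le> norm (T x) / p x" using p by simp
    then show ?thesis using that x by force
  qed
  then show ?thesis
    unfolding onorm_on_def cSUP_le_iff[OF \<open>S \<noteq> {}\<close> bdd] using le by blast
qed

lemma onorm_on_bound:
  assumes "S \<noteq> {}" "\<And>x. x \<in> S \<Longrightarrow> 0 \<le> p x" "\<exists>K. \<forall>x\<in>S. norm (T x) \<le> K * p x"
  shows "x \<in> S \<Longrightarrow> norm (T x) \<le> onorm_on S p T * p x" and "0 \<le> onorm_on S p T"
  using onorm_on_le_iff[of S p T "onorm_on S p T"] assms by auto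

text \<open>
  Here zero vectors are excluded from the supremum.  Nonzero vectors in \<open>M\<close> and \<open>N\<close> are what
  makes it a supremum of a nonempty set.
\<close>
lemma bilinear_norm_on_le_iff:
  assumes \<phi>: "bounded_bilinear_on M N sX sY sZ \<phi>"
    and X: "vector_space sX" and Y: "vector_space sY" and Z: "vector_space sZ"
    and M: "\<exists>x\<in>M. x \<noteq> 0" and N: "\<exists>y\<in>N. y \<noteq> 0"
  shows "bilinear_norm_on M N \<phi> \<le> K \<longleftrightarrow>
    0 \<le> K \<and> (\<forall>x\<in>M. \<forall>y\<in>N. norm (\<phi> x y) \<le> K * (norm x * norm y))"
proof -
  interpret X: vector_space sX by fact
  interpret Y: vector_space sY by fact
  interpret Z: vector_space sZ by fact
  let ?I = "(M - {0}) \<times> (N - {0})" and ?r = "\<lambda>(x, y). norm (\<phi> x y) / (norm x * norm y)"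
  obtain L where L: "\<And>x y. x \<in> M \<Longrightarrow> y \<in> N \<Longrightarrow> norm (\<phi> x y) \<le> L * (norm x * norm y)"
    using \<phi> by (auto simp: bounded_bilinear_on_def)
  have "\<phi> x y = 0" if "x \<in> M" "y \<in> N" "x = 0 \<or> y = 0" for x y
    using L[OF that(1,2)] that(3) by auto
  then have zero: "norm (\<phi> x y) \<le> K * (norm x * norm y)" if "x \<in> M" "y \<in> N" "x = 0 \<or> y = 0" for x y
    using that by auto
  have ne: "?I \<noteq> {}"
    using M N by blast
  have le: "norm (\<phi> x y) / (norm x * norm y) \<le> K \<longleftrightarrow> norm (\<phi> x y) \<le> K * (norm x * norm y)"
    if "x \<noteq> 0" "y \<noteq> 0" for x y K
    using that by (simp add: pos_divide_le_eq)
  have bdd: "bdd_above (?r ` ?I)"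
  proof (rule bdd_aboveI2[where M = L])
    fix i assume "i \<in> ?I"
    then show "?r i \<le> L"
      using L[of "fst i" "snd i"] le[of "fst i" "snd i" L] by (simp add: case_prod_beta mem_Times_iff)
  qed
  have "0 \<le> K" if "\<forall>i\<in>?I. ?r i \<le> K"
  proof -
    obtain i where "i \<in> ?I" using ne by blast
    then have "?r i \<le> K" using that by blast
    moreover have "0 \<le> ?r i" by (simp add: case_prod_beta)
    ultimately show ?thesis by linarith
  qed
  moreover have "(\<forall>i\<in>?I. ?r i \<le> K) \<longleftrightarrow>
      (\<forall>x\<in>M. \<forall>y\<in>N. norm (\<phi> x y) \<le> K * (norm x * norm y))"
  proof (intro iffI ballI)
    fix x y assume *: "\<forall>i\<in>?I. ?r i \<le> K" and xy: "x \<in> M" "y \<in> N"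
    show "norm (\<phi> x y) \<le> K * (norm x * norm y)"
    proof (cases "x = 0 \<or> y = 0")
      case True
      then show ?thesis using zero xy by blast
    next
      case False
      then show ?thesis using *[rule_format, of "(x, y)"] xy le[of x y K] by simp
    qed
  next
    fix i assume *: "\<forall>x\<in>M. \<forall>y\<in>N. norm (\<phi> x y) \<le> K * (norm x * norm y)" and i: "i \<in> ?I"
    then show "?r i \<le> K"
      using le[of "fst i" "snd i" K] by (simp add: case_prod_beta mem_Times_iff)
  qed
  ultimately show ?thesis
    unfolding bilinear_norm_on_def cSUP_le_iff[OF ne bdd] by blast
qed

section \<open>The projective norm\<close>

lemma linear_map_on_sum:
  assumes "vector_space s" and "module.subspace s S" and "vector_space s'"
    and T: "linear_map_on S s s' T" and f: "\<And>i. i < n \<Longrightarrow> f i \<in> S"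
  shows "T (\<Sum>i<n::nat. f i) = (\<Sum>i<n. T (f i))"
proof -
  interpret vector_space s by fact
  interpret Z: vector_space s' by fact
  have "T (s 0 0) = s' 0 (T 0)"
    using T subspace_0[OF assms(2)] unfolding linear_map_on_def by blast
  then have "T 0 = 0" by simp
  then have "T (\<Sum>i<k. f i) = (\<Sum>i<k. T (f i))" if "k \<le> n" for k
    using that
  proof (induction k)
    case (Suc k)
    have "(\<Sum>i<k. f i) \<in> S"
      using Suc.prems f by (intro subspace_sum[OF assms(2)]) auto
    then show ?case
      using Suc T f[of k] by (simp add: linear_map_on_def)
  qed simp
  then show ?thesis by simp
qed

context
  fixes sX :: "'f::real_or_complex \<Rightarrow> 'x::banach \<Rightarrow> 'x" and sY :: "'f \<Rightarrow> 'y::banach \<Rightarrow> 'y"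
    and M :: "'x set" and N :: "'y set"
  assumes X: "banach_space_over sX" and Y: "banach_space_over sY"
    and M: "module.subspace sX M" and N: "module.subspace sY N"
begin

interpretation X: banach_space_over sX by (fact X)
interpretation Y: banach_space_over sY by (fact Y)
interpretation t: vector_space "tensor_scale :: 'f \<Rightarrow> ('f, 'x, 'y) tensor \<Rightarrow> _"
  by (rule vector_space_tensor_scale)

text \<open>
  \<open>r\<close> is the value of a representation of \<open>F\<close> by elementary tensors, so that the projective norm
  is the infimum of these \<open>r\<close>.  In this form addition and scaling of representations can be
  expressed without mentioning their entries.
\<close>
definition representation :: "('f, 'x, 'y) tensor \<Rightarrow> real \<Rightarrow> bool"
  where "representation F r \<longleftrightarrow>
    (\<exists>(n::nat) x y. r = (\<Sum>i<n. norm (x i) * norm (y i)) \<and> (\<forall>i<n. x i \<in> M \<and> y i \<in> N) \<and>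
      F = (\<Sum>i<n. tensor sX sY (x i) (y i)))"

lemma projective_norm_eq: "projective_norm sX sY M N F = Inf {r. representation F r}"
  unfolding projective_norm_def representation_def by (rule arg_cong[where f = Inf]) blast

lemma representation_nonneg: "representation F r \<Longrightarrow> 0 \<le> r"
  by (auto simp: representation_def intro!: sum_nonneg)

lemma projective_norm_le: "representation F r \<Longrightarrow> projective_norm sX sY M N F \<le> r"
  unfolding projective_norm_eq
  by (rule cInf_lower) (auto intro!: bdd_belowI[of _ 0] representation_nonneg)

lemma representation_tensor:
  assumes "x \<in> M" "y \<in> N"
  shows "representation (tensor sX sY x y) (norm x * norm y)"
  unfolding representation_def
  by (rule exI[of _ 1], rule exI[of _ "\<lambda>_. x"], rule exI[of _ "\<lambda>_. y"]) (simp add: assms)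

lemma representation_0: "representation 0 0"
  unfolding representation_def by (rule exI[of _ 0]) simp

lemma representation_add:
  assumes "representation F r" "representation G r'"
  shows "representation (F + G) (r + r')"
proof -
  obtain n :: nat and x y where 1: "r = (\<Sum>i<n. norm (x i) * norm (y i))"
    "\<And>i. i < n \<Longrightarrow> x i \<in> M \<and> y i \<in> N" "F = (\<Sum>i<n. tensor sX sY (x i) (y i))"
    using assms(1) unfolding representation_def by blast
  obtain m :: nat and x' y' where 2: "r' = (\<Sum>i<m. norm (x' i) * norm (y' i))"
    "\<And>i. i < m \<Longrightarrow> x' i \<in> M \<and> y' i \<in> N" "G = (\<Sum>i<m. tensor sX sY (x' i) (y' i))"
    using assms(2) unfolding representation_def by blast
  \<comment> \<open>Concatenation of the two representations.\<close>
  let ?x = "\<lambda>i. if i < n then x i else x' (i - n)" and ?y = "\<lambda>i. if i < n then y i else y' (i - n)"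
  have split: "(\<Sum>i<n + m. h (?x i) (?y i)) = (\<Sum>i<n. h (x i) (y i)) + (\<Sum>i<m. h (x' i) (y' i))"
    for h :: "'x \<Rightarrow> 'y \<Rightarrow> 'w::comm_monoid_add"
  proof -
    have "(\<Sum>i<k. h (?x (n + i)) (?y (n + i))) = (\<Sum>i<k. h (x' i) (y' i))" for k :: nat
      by simp
    moreover have "(\<Sum>i<n + k. h (?x i) (?y i)) =
        (\<Sum>i<n. h (?x i) (?y i)) + (\<Sum>i<k. h (?x (n + i)) (?y (n + i)))" for k
      by (induction k) (simp_all add: add.assoc)
    ultimately show ?thesis by simp
  qed
  show ?thesis
    unfolding representation_def
    using 1 2 split[of "\<lambda>x y. norm x * norm y"] split[of "tensor sX sY"]
    by (intro exI[of _ "n + m"] exI[of _ ?x] exI[of _ ?y]) auto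
qed

lemma tensor_scale_left: "tensor sX sY (sX c x) y = tensor_scale c (tensor sX sY x y)"
  using bilinear_on_tensor[of sX sY] by (simp add: bilinear_on_def linear_map_on_def)

lemma representation_scale:
  assumes "representation F r"
  shows "representation (tensor_scale c F) (norm c * r)"
proof -
  obtain n :: nat and x y where 1: "r = (\<Sum>i<n. norm (x i) * norm (y i))"
    "\<And>i. i < n \<Longrightarrow> x i \<in> M \<and> y i \<in> N" "F = (\<Sum>i<n. tensor sX sY (x i) (y i))"
    using assms(1) unfolding representation_def by blast
  have "norm c * r = (\<Sum>i<n. norm (sX c (x i)) * norm (y i))"
    by (simp add: 1 X.norm_scale sum_distrib_left mult.assoc)
  moreover have "tensor_scale c F = (\<Sum>i<n. tensor sX sY (sX c (x i)) (y i))"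
    by (simp add: 1 t.scale_sum_right tensor_scale_left)
  ultimately show ?thesis
    unfolding representation_def
    using 1(2) X.subspace_scale[OF M]
    by (intro exI[of _ n] exI[of _ "\<lambda>i. sX c (x i)"] exI[of _ y]) auto
qed

lemma tensor_in_tensor_space: "x \<in> M \<Longrightarrow> y \<in> N \<Longrightarrow> tensor sX sY x y \<in> tensor_space sX sY M N"
  unfolding tensor_space_def by (rule t.span_base) blast

lemma ex_representation:
  assumes "F \<in> tensor_space sX sY M N"
  shows "\<exists>r. representation F r"
  using assms unfolding tensor_space_def
proof (induction rule: t.span_induct_alt)
  case base
  show ?case using representation_0 by blast
next
  case (step c F G)
  then show ?case
    using representation_add representation_scale representation_tensor by blast
qed

lemma projective_norm_greatest:
  assumes "F \<in> tensor_space sX sY M N" and "\<And>r. representation F r \<Longrightarrow> a \<le> r"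
  shows "a \<le> projective_norm sX sY M N F"
  unfolding projective_norm_eq using assms ex_representation by (intro cInf_greatest) auto

lemma seminormed_space_projective_norm:
  "seminormed_space tensor_scale (tensor_space sX sY M N) (projective_norm sX sY M N)"
proof
  let ?S = "tensor_space sX sY M N" and ?q = "projective_norm sX sY M N"
  show sub: "t.subspace ?S"
    unfolding tensor_space_def by (rule t.subspace_span)
  show nonneg: "0 \<le> ?q F" if "F \<in> ?S" for F
    using that representation_nonneg by (rule projective_norm_greatest)
  show "?q (F + G) \<le> ?q F + ?q G" if "F \<in> ?S" "G \<in> ?S" for F G
  proof -
    have "?q (F + G) - r \<le> ?q G" if r: "representation F r" for r
      using \<open>G \<in> ?S\<close>
    proof (rule projective_norm_greatest)
      show "?q (F + G) - r \<le> r'" if "representation G r'" for r'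
        using projective_norm_le[OF representation_add[OF r that]] by simp
    qed
    then have "?q (F + G) - ?q G \<le> ?q F"
      using that(1) by (intro projective_norm_greatest) (auto simp: algebra_simps)
    then show ?thesis by simp
  qed
  have le: "norm c * ?q F \<ge> ?q (tensor_scale c F)" if F: "F \<in> ?S" and c: "c \<noteq> 0" for F c
  proof -
    have "?q (tensor_scale c F) / norm c \<le> ?q F"
      using F
    proof (rule projective_norm_greatest)
      show "?q (tensor_scale c F) / norm c \<le> r" if "representation F r" for r
        using projective_norm_le[OF representation_scale[OF that, of c]] c
        by (simp add: divide_simps mult.commute)
    qed
    then show ?thesis using c by (simp add: divide_simps mult.commute)
  qed
  show "?q (tensor_scale c F) = norm c * ?q F" if F: "F \<in> ?S" for F c
  proof (cases "c = 0")
    case True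
    then show ?thesis
      using projective_norm_le[OF representation_0] nonneg[OF t.subspace_0[OF sub]] by simp
  next
    case False
    \<comment> \<open>The reverse inequality is the one just proved, for the scalar \<open>1 / c\<close>.\<close>
    have "norm (inverse c) * ?q (tensor_scale c F) \<ge> ?q (tensor_scale (inverse c) (tensor_scale c F))"
      using le[of "tensor_scale c F" "inverse c"] False t.subspace_scale[OF sub F] by simp
    then have "?q (tensor_scale c F) \<ge> norm c * ?q F"
      using False by (simp add: norm_inverse norm_divide divide_simps mult.commute)
    then show ?thesis using le[OF F False] by simp
  qed
qed

text \<open>
  A bound on elementary tensors extends to all tensors, as the projective norm is the largest
  seminorm that is at most \<open>\<parallel>x\<parallel> \<parallel>y\<parallel>\<close> on every \<open>x \<otimes> y\<close>.
\<close>
lemma tensor_space_bound: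
  fixes sZ :: "'f \<Rightarrow> 'z::banach \<Rightarrow> 'z"
  assumes Z: "banach_space_over sZ"
    and T: "linear_map_on (tensor_space sX sY M N) tensor_scale sZ T"
    and K: "0 \<le> K" "\<And>x y. x \<in> M \<Longrightarrow> y \<in> N \<Longrightarrow> norm (T (tensor sX sY x y)) \<le> K * (norm x * norm y)"
    and F: "F \<in> tensor_space sX sY M N"
  shows "norm (T F) \<le> K * projective_norm sX sY M N F"
proof -
  interpret Z: banach_space_over sZ by fact
  have le: "norm (T F) \<le> K * r" if r: "representation F r" for r
  proof -
    obtain n :: nat and x y where 1: "r = (\<Sum>i<n. norm (x i) * norm (y i))"
      "\<And>i. i < n \<Longrightarrow> x i \<in> M \<and> y i \<in> N" "F = (\<Sum>i<n. tensor sX sY (x i) (y i))"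
      using r unfolding representation_def by blast
    have "T F = (\<Sum>i<n. T (tensor sX sY (x i) (y i)))"
      unfolding 1(3) using 1(2) tensor_in_tensor_space
      by (intro linear_map_on_sum[OF t.vector_space_axioms _ Z.vector_space_axioms T])
        (auto simp: tensor_space_def t.subspace_span)
    also have "norm \<dots> \<le> (\<Sum>i<n. K * (norm (x i) * norm (y i)))"
      using 1(2) K by (intro sum_norm_le) auto
    finally show ?thesis
      by (simp add: 1(1) sum_distrib_left)
  qed
  show ?thesis
  proof (cases "K = 0")
    case True
    then show ?thesis using le ex_representation[OF F] by auto
  next
    case False
    have "norm (T F) / K \<le> projective_norm sX sY M N F"
      using F by (rule projective_norm_greatest) (use le K(1) False in \<open>simp add: divide_simps mult.commute\<close>)
    then show ?thesis using K(1) False by (simp add: divide_simps mult.commute)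
  qed
qed

text \<open>
  The isometry between bounded bilinear maps and bounded linear maps on the projective tensor
  product.  Both have the same best constants: one direction is the previous lemma, the other
  uses that the projective norm of \<open>x \<otimes> y\<close> is at most \<open>\<parallel>x\<parallel> \<parallel>y\<parallel>\<close>.
\<close>
lemma bounded_linear_on_tensor_space_iff:
  fixes sZ :: "'f \<Rightarrow> 'z::banach \<Rightarrow> 'z"
  assumes Z: "banach_space_over sZ" and ne: "\<exists>x\<in>M. x \<noteq> 0" "\<exists>y\<in>N. y \<noteq> 0"
    and T: "linear_map_on (tensor_space sX sY M N) tensor_scale sZ T"
    and \<phi>: "\<And>x y. x \<in> M \<Longrightarrow> y \<in> N \<Longrightarrow> T (tensor sX sY x y) = \<phi> x y"
  shows "bounded_linear_on (tensor_space sX sY M N) (projective_norm sX sY M N) tensor_scale sZ T \<longleftrightarrow>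
      bounded_bilinear_on M N sX sY sZ \<phi>" (is "?linear \<longleftrightarrow> ?bilinear")
    and "bounded_bilinear_on M N sX sY sZ \<phi> \<Longrightarrow>
      onorm_on (tensor_space sX sY M N) (projective_norm sX sY M N) T = bilinear_norm_on M N \<phi>"
proof -
  let ?S = "tensor_space sX sY M N" and ?q = "projective_norm sX sY M N"
  interpret Z: banach_space_over sZ by fact
  interpret q: seminormed_space tensor_scale ?S ?q
    by (rule seminormed_space_projective_norm)
  have bil: "bilinear_on M N sX sY sZ \<phi>"
    using T bilinear_on_tensor[of sX sY] X.subspace_add[OF M] X.subspace_scale[OF M]
      Y.subspace_add[OF N] Y.subspace_scale[OF N] tensor_in_tensor_space
    by (simp add: bilinear_on_def linear_map_on_def flip: \<phi>)
  have bound: "(\<forall>F\<in>?S. norm (T F) \<le> K * ?q F) \<longleftrightarrow>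
      (\<forall>x\<in>M. \<forall>y\<in>N. norm (\<phi> x y) \<le> K * (norm x * norm y))" if K: "0 \<le> K" for K
  proof (intro iffI ballI)
    fix x y assume *: "\<forall>F\<in>?S. norm (T F) \<le> K * ?q F" and xy: "x \<in> M" "y \<in> N"
    have "norm (\<phi> x y) \<le> K * ?q (tensor sX sY x y)"
      using *[rule_format, OF tensor_in_tensor_space[OF xy]] by (simp add: \<phi> xy)
    also have "\<dots> \<le> K * (norm x * norm y)"
      using projective_norm_le[OF representation_tensor[OF xy]] K by (rule mult_left_mono)
    finally show "norm (\<phi> x y) \<le> K * (norm x * norm y)" .
  qed (auto intro!: tensor_space_bound[OF Z T K] simp: \<phi>)
  show iff: "?linear \<longleftrightarrow> ?bilinear"
  proof
    assume ?linear
    then obtain K where "\<And>F. F \<in> ?S \<Longrightarrow> norm (T F) \<le> K * ?q F"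
      by (auto simp: bounded_linear_on_def)
    then have "\<forall>F\<in>?S. norm (T F) \<le> max K 0 * ?q F"
      using q.nonneg by (meson max.cobounded1 mult_right_mono order_trans)
    then show ?bilinear
      using bound[of "max K 0"] bil by (auto simp: bounded_bilinear_on_def)
  next
    assume ?bilinear
    then obtain K where "\<And>x y. x \<in> M \<Longrightarrow> y \<in> N \<Longrightarrow> norm (\<phi> x y) \<le> K * (norm x * norm y)"
      by (auto simp: bounded_bilinear_on_def)
    then have "\<forall>x\<in>M. \<forall>y\<in>N. norm (\<phi> x y) \<le> max K 0 * (norm x * norm y)"
      by (meson max.cobounded1 mult_right_mono order_trans mult_nonneg_nonneg norm_ge_zero)
    then show ?linear
      using bound[of "max K 0"] T by (auto simp: bounded_linear_on_def)
  qed
  assume \<phi>': ?bilinear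
  have S: "?S \<noteq> {}"
    using t.subspace_0[OF q.subspace] by blast
  have bdd: "\<exists>K. \<forall>F\<in>?S. norm (T F) \<le> K * ?q F"
    using iff \<phi>' by (auto simp: bounded_linear_on_def)
  have "onorm_on ?S ?q T \<le> K \<longleftrightarrow> bilinear_norm_on M N \<phi> \<le> K" for K
  proof -
    have "onorm_on ?S ?q T \<le> K \<longleftrightarrow> 0 \<le> K \<and> (\<forall>F\<in>?S. norm (T F) \<le> K * ?q F)"
      by (rule onorm_on_le_iff[OF S q.nonneg bdd])
    also have "\<dots> \<longleftrightarrow> 0 \<le> K \<and> (\<forall>x\<in>M. \<forall>y\<in>N. norm (\<phi> x y) \<le> K * (norm x * norm y))"
      using bound by (intro conj_cong refl)
    also have "\<dots> \<longleftrightarrow> bilinear_norm_on M N \<phi> \<le> K"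
      by (rule bilinear_norm_on_le_iff[OF \<phi>' X.vector_space_axioms Y.vector_space_axioms
        Z.vector_space_axioms ne, symmetric])
    finally show ?thesis .
  qed
  then show "onorm_on ?S ?q T = bilinear_norm_on M N \<phi>"
    by (meson antisym order_refl)
qed

end

section \<open>Bounded linear maps and completions\<close>

context seminormed_space
begin

abbreviation cls :: "(nat \<Rightarrow> 'v) \<Rightarrow> (nat \<Rightarrow> 'v) set"
  where "cls u \<equiv> u +o null_seqs S q"

lemma in_S: "0 \<in> S" "x \<in> S \<Longrightarrow> y \<in> S \<Longrightarrow> x + y \<in> S" "x \<in> S \<Longrightarrow> y \<in> S \<Longrightarrow> x - y \<in> S"
  "x \<in> S \<Longrightarrow> s c x \<in> S"
  using subspace subspace_0 subspace_add subspace_diff subspace_scale by blast+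

lemma seminorm_0: "q 0 = 0"
  using homogeneous[OF in_S(1), of 0] by simp

lemma seminorm_minus: "x \<in> S \<Longrightarrow> q (- x) = q x"
  using homogeneous[of x "- 1"] by simp

lemma seminorm_diff_commute: "x \<in> S \<Longrightarrow> y \<in> S \<Longrightarrow> q (x - y) = q (y - x)"
  using seminorm_minus[OF in_S(3), of x y] by simp

lemma abs_seminorm_diff: "x \<in> S \<Longrightarrow> y \<in> S \<Longrightarrow> \<bar>q x - q y\<bar> \<le> q (x - y)"
  using triangle[of "x - y" y] triangle[of "y - x" x] seminorm_diff_commute[of x y] in_S(3)[of x y]
    in_S(3)[of y x] by simp

lemma null_seqs_S: "u \<in> null_seqs S q \<Longrightarrow> u n \<in> S"
  by (auto simp: null_seqs_def)

lemma cauchy_seqs_S: "u \<in> cauchy_seqs S q \<Longrightarrow> u n \<in> S"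
  by (auto simp: cauchy_seqs_def)

lemma cauchy_seqsD:
  assumes "u \<in> cauchy_seqs S q" and "e > 0"
  obtains k where "\<And>m n. m \<ge> k \<Longrightarrow> n \<ge> k \<Longrightarrow> q (u m - u n) < e"
  using assms unfolding cauchy_seqs_def by force

lemma zero_null_seq: "0 \<in> null_seqs S q"
  using in_S(1) by (auto simp: null_seqs_def seminorm_0)

lemma null_seqI:
  assumes "\<And>n. u n \<in> S" and "v \<longlonglongrightarrow> 0" and "\<And>n. q (u n) \<le> v n"
  shows "u \<in> null_seqs S q"
  unfolding null_seqs_def
proof (intro CollectI conjI)
  show "(\<lambda>n. q (u n)) \<longlonglongrightarrow> 0"
    using tendsto_const assms(2) by (rule real_tendsto_sandwich[rotated 2]) (use assms nonneg in auto)
qed (use assms in auto)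

lemma null_seqs_tendsto: "u \<in> null_seqs S q \<Longrightarrow> (\<lambda>n. q (u n)) \<longlonglongrightarrow> 0"
  by (simp add: null_seqs_def)

lemma null_seqs_add:
  assumes "u \<in> null_seqs S q" "v \<in> null_seqs S q"
  shows "u + v \<in> null_seqs S q"
  using tendsto_add[OF assms[THEN null_seqs_tendsto]] null_seqs_S[OF assms(1)] null_seqs_S[OF assms(2)]
  by (intro null_seqI[where v = "\<lambda>n. q (u n) + q (v n)"]) (auto intro: in_S triangle)

lemma null_seqs_scale:
  assumes "u \<in> null_seqs S q"
  shows "(\<lambda>n. s c (u n)) \<in> null_seqs S q"
  using tendsto_mult_right_zero[OF null_seqs_tendsto[OF assms], of "norm c"] null_seqs_S[OF assms]
  by (intro null_seqI[where v = "\<lambda>n. norm c * q (u n)"]) (auto intro: in_S simp: homogeneous)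

lemma null_seqs_plus: "null_seqs S q + null_seqs S q = null_seqs S q"
proof
  show "null_seqs S q + null_seqs S q \<subseteq> null_seqs S q"
    by (auto simp: set_plus_def intro: null_seqs_add)
  show "null_seqs S q \<subseteq> null_seqs S q + null_seqs S q"
    using set_plus_intro[OF zero_null_seq] by force
qed

lemma mem_cls_iff: "v \<in> cls u \<longleftrightarrow> v - u \<in> null_seqs S q"
  by (force simp: elt_set_plus_def)

lemma mem_cls: "u \<in> cls u"
  by (simp add: mem_cls_iff zero_null_seq)

lemma cls_add: "cls u + cls v = cls (u + v)"
  by (simp add: set_plus_rearrange null_seqs_plus)

lemma cls_in_completion: "u \<in> cauchy_seqs S q \<Longrightarrow> cls u \<in> completion S q"
  by (simp add: completion_def)

lemma completion_scale_cls: "completion_scale S q s c (cls u) = cls (\<lambda>n. s c (u n))"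
proof -
  have "(\<lambda>v n. s c (v n)) ` cls u + null_seqs S q \<subseteq> cls (\<lambda>n. s c (u n))"
  proof
    fix w assume "w \<in> (\<lambda>v n. s c (v n)) ` cls u + null_seqs S q"
    then obtain v z where w: "w = (\<lambda>n. s c (v n)) + z" "v - u \<in> null_seqs S q" "z \<in> null_seqs S q"
      by (auto simp: set_plus_def mem_cls_iff)
    have "w - (\<lambda>n. s c (u n)) = (\<lambda>n. s c ((v - u) n)) + z"
      by (auto simp: w(1) fun_eq_iff scale_right_diff_distrib)
    then show "w \<in> cls (\<lambda>n. s c (u n))"
      using null_seqs_add[OF null_seqs_scale[OF w(2)] w(3)] by (simp add: mem_cls_iff)
  qed
  moreover have "cls (\<lambda>n. s c (u n)) \<subseteq> (\<lambda>v n. s c (v n)) ` cls u + null_seqs S q"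
    unfolding elt_set_plus_def[of "\<lambda>n. s c (u n)"] using mem_cls[of u] by (auto intro!: set_plus_intro)
  ultimately show ?thesis
    unfolding completion_scale_def by blast
qed

text \<open>
  A sequence is Cauchy if its increments are controlled by those of a Cauchy sequence.  This
  covers scalar multiples (\<open>K = norm c\<close>) and translates (\<open>K = 1\<close>).
\<close>
lemma cauchy_seqI:
  assumes "\<And>n. u n \<in> S" and "v \<in> cauchy_seqs S q"
    and "\<And>m n. q (u m - u n) \<le> K * q (v m - v n)"
  shows "u \<in> cauchy_seqs S q"
  unfolding cauchy_seqs_def
proof (intro CollectI conjI allI impI)
  fix e :: real assume "e > 0"
  then have pos: "e / (\<bar>K\<bar> + 1) > 0" by simp
  obtain k where k: "\<And>m n. m \<ge> k \<Longrightarrow> n \<ge> k \<Longrightarrow> q (v m - v n) < e / (\<bar>K\<bar> + 1)"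
    using cauchy_seqsD[OF assms(2) pos] by blast
  have "q (u m - u n) < e" if "m \<ge> k" "n \<ge> k" for m n
  proof -
    have "q (u m - u n) \<le> (\<bar>K\<bar> + 1) * q (v m - v n)"
      using nonneg[OF in_S(3)[OF cauchy_seqs_S[OF assms(2)] cauchy_seqs_S[OF assms(2)]]]
      by (intro order_trans[OF assms(3)] mult_right_mono) auto
    also have "\<dots> < e"
      using k[OF that] by (simp add: pos_less_divide_eq mult.commute)
    finally show ?thesis .
  qed
  then show "\<exists>k. \<forall>m\<ge>k. \<forall>n\<ge>k. q (u m - u n) < e" by blast
qed (use assms in auto)

lemma cauchy_seqs_scale:
  assumes "u \<in> cauchy_seqs S q"
  shows "(\<lambda>n. s c (u n)) \<in> cauchy_seqs S q"
proof (rule cauchy_seqI[OF _ assms, where K = "norm c"])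
  show "q (s c (u m) - s c (u n)) \<le> norm c * q (u m - u n)" for m n
    using homogeneous[OF in_S(3), of "u m" "u n" c] cauchy_seqs_S[OF assms]
    by (simp add: scale_right_diff_distrib)
qed (use cauchy_seqs_S[OF assms] in_S in auto)

lemma cauchy_seqs_add:
  assumes u: "u \<in> cauchy_seqs S q" and v: "v \<in> cauchy_seqs S q"
  shows "u + v \<in> cauchy_seqs S q"
  unfolding cauchy_seqs_def
proof (intro CollectI conjI allI impI)
  show "range (u + v) \<subseteq> S"
    using cauchy_seqs_S[OF u] cauchy_seqs_S[OF v] in_S by auto
  fix e :: real assume e: "e > 0"
  obtain k where k: "\<And>m n. m \<ge> k \<Longrightarrow> n \<ge> k \<Longrightarrow> q (u m - u n) < e / 2"
    using cauchy_seqsD[OF u half_gt_zero[OF e]] by blast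
  obtain l where l: "\<And>m n. m \<ge> l \<Longrightarrow> n \<ge> l \<Longrightarrow> q (v m - v n) < e / 2"
    using cauchy_seqsD[OF v half_gt_zero[OF e]] by blast
  have "q ((u + v) m - (u + v) n) < e" if "m \<ge> max k l" "n \<ge> max k l" for m n
  proof -
    have "q ((u m - u n) + (v m - v n)) \<le> q (u m - u n) + q (v m - v n)"
      using cauchy_seqs_S[OF u] cauchy_seqs_S[OF v] in_S by (intro triangle) auto
    then show ?thesis
      using k[of m n] l[of m n] that by (simp add: algebra_simps)
  qed
  then show "\<exists>k. \<forall>m\<ge>k. \<forall>n\<ge>k. q ((u + v) m - (u + v) n) < e" by blast
qed

lemma const_cauchy_seq: "x \<in> S \<Longrightarrow> (\<lambda>_. x) \<in> cauchy_seqs S q"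
  by (auto simp: cauchy_seqs_def seminorm_0)

lemma completion_norm_tendsto:
  assumes u: "u \<in> cauchy_seqs S q"
  shows "(\<lambda>n. q (u n)) \<longlonglongrightarrow> completion_norm q (cls u)"
proof -
  have uS: "u n \<in> S" for n
    using u by (rule cauchy_seqs_S)
  have "Cauchy (\<lambda>n. q (u n))"
    unfolding Cauchy_def
  proof (intro allI impI)
    fix e :: real assume e: "e > 0"
    obtain k where "\<And>m n. m \<ge> k \<Longrightarrow> n \<ge> k \<Longrightarrow> q (u m - u n) < e"
      using cauchy_seqsD[OF u e] by blast
    then show "\<exists>k. \<forall>m\<ge>k. \<forall>n\<ge>k. dist (q (u m)) (q (u n)) < e"
      unfolding dist_real_def using abs_seminorm_diff[OF uS uS] by (meson le_less_trans)
  qed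
  then obtain l where l: "(\<lambda>n. q (u n)) \<longlonglongrightarrow> l"
    using Cauchy_convergent convergent_def by blast
  have "completion_norm q (cls u) = l"
    unfolding completion_norm_def
  proof (rule the_equality)
    show "\<forall>v\<in>cls u. (\<lambda>n. q (v n)) \<longlonglongrightarrow> l"
    proof
      fix v assume "v \<in> cls u"
      then have v: "v - u \<in> null_seqs S q"
        by (simp add: mem_cls_iff)
      have vS: "v n \<in> S" for n
        using in_S(2)[OF null_seqs_S[OF v] uS, of n n] by simp
      have "(\<lambda>n. q (v n) - q (u n)) \<longlonglongrightarrow> 0"
      proof (rule Lim_null_comparison)
        show "\<forall>\<^sub>F n in sequentially. norm (q (v n) - q (u n)) \<le> q ((v - u) n)"
          unfolding real_norm_def minus_apply by (intro always_eventually allI abs_seminorm_diff vS uS)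
        show "(\<lambda>n. q ((v - u) n)) \<longlonglongrightarrow> 0"
          by (rule null_seqs_tendsto[OF v])
      qed
      from tendsto_add[OF this l] show "(\<lambda>n. q (v n)) \<longlonglongrightarrow> l"
        by simp
    qed
    show "l' = l" if "\<forall>v\<in>cls u. (\<lambda>n. q (v n)) \<longlonglongrightarrow> l'" for l'
      using that mem_cls l LIMSEQ_unique by blast
  qed
  with l show ?thesis by simp
qed

lemma completion_norm_nonneg: "u \<in> cauchy_seqs S q \<Longrightarrow> 0 \<le> completion_norm q (cls u)"
  by (rule LIMSEQ_le_const[OF completion_norm_tendsto]) (auto intro: nonneg cauchy_seqs_S)

lemma completion_norm_const: "x \<in> S \<Longrightarrow> completion_norm q (cls (\<lambda>_. x)) = q x"
  using completion_norm_tendsto[OF const_cauchy_seq] LIMSEQ_unique tendsto_const by blast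

text \<open>
  The constant sequences are dense: a Cauchy sequence \<open>u\<close>, as a point of the completion, is the
  limit of its own entries.
\<close>
lemma cauchy_seq_approximation:
  assumes u: "u \<in> cauchy_seqs S q"
  shows "(\<lambda>n. completion_norm q (cls (u - (\<lambda>_. u n)))) \<longlonglongrightarrow> 0"
proof (rule LIMSEQ_I)
  fix e :: real assume e: "e > 0"
  obtain k where k: "\<And>m n. m \<ge> k \<Longrightarrow> n \<ge> k \<Longrightarrow> q (u m - u n) < e / 2"
    using cauchy_seqsD[OF u half_gt_zero[OF e]] by blast
  have "norm (completion_norm q (cls (u - (\<lambda>_. u n))) - 0) < e" if n: "n \<ge> k" for n
  proof -
    have c: "u - (\<lambda>_. u n) \<in> cauchy_seqs S q"
      by (rule cauchy_seqI[OF _ u, where K = 1]) (use cauchy_seqs_S[OF u] in_S in auto)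
    have "completion_norm q (cls (u - (\<lambda>_. u n))) \<le> e / 2"
      using completion_norm_tendsto[OF c]
      by (rule LIMSEQ_le_const2) (use k[OF _ n] in \<open>auto intro!: exI[of _ k] less_imp_le\<close>)
    then show ?thesis
      using completion_norm_nonneg[OF c] e by simp
  qed
  then show "\<exists>k. \<forall>n\<ge>k. norm (completion_norm q (cls (u - (\<lambda>_. u n))) - 0) < e" by blast
qed

lemma bounded_linear_on_completion_tendsto:
  assumes T: "bounded_linear_on (completion S q) (completion_norm q) (completion_scale S q s) sZ T"
    and u: "u \<in> cauchy_seqs S q"
  shows "(\<lambda>n. T (cls (\<lambda>_. u n))) \<longlonglongrightarrow> T (cls u)"
proof -
  obtain K where K: "\<And>A. A \<in> completion S q \<Longrightarrow> norm (T A) \<le> K * completion_norm q A"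
    using T by (auto simp: bounded_linear_on_def)
  have add: "T (A + B) = T A + T B" if "A \<in> completion S q" "B \<in> completion S q" for A B
    using T that by (simp add: bounded_linear_on_def linear_map_on_def)
  have le: "norm (T (cls u) - T (cls (\<lambda>_. u n))) \<le> K * completion_norm q (cls (u - (\<lambda>_. u n)))" for n
  proof -
    have c: "u - (\<lambda>_. u n) \<in> cauchy_seqs S q"
      by (rule cauchy_seqI[OF _ u, where K = 1]) (use cauchy_seqs_S[OF u] in_S in auto)
    have "T (cls u) = T (cls (u - (\<lambda>_. u n))) + T (cls (\<lambda>_. u n))"
      using add[OF cls_in_completion[OF c]
          cls_in_completion[OF const_cauchy_seq[OF cauchy_seqs_S[OF u, of n]]]]
      by (simp add: cls_add)
    then show ?thesis
      using K[OF cls_in_completion[OF c]] by simp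
  qed
  have "(\<lambda>n. T (cls u) - T (cls (\<lambda>_. u n))) \<longlonglongrightarrow> 0"
  proof (rule Lim_null_comparison)
    show "\<forall>\<^sub>F n in sequentially. norm (T (cls u) - T (cls (\<lambda>_. u n))) \<le>
        K * completion_norm q (cls (u - (\<lambda>_. u n)))"
      by (intro always_eventually allI le)
    show "(\<lambda>n. K * completion_norm q (cls (u - (\<lambda>_. u n)))) \<longlonglongrightarrow> 0"
      by (rule tendsto_mult_right_zero[OF cauchy_seq_approximation[OF u]])
  qed
  from tendsto_diff[OF tendsto_const[of "T (cls u)"] this] show ?thesis by simp
qed

text \<open>
  \<open>S\<close> embeds isometrically into its completion as the classes of constant sequences, so that
  restricting an operator does not increase its norm.
\<close>
lemma restriction_from_completion:
  assumes T: "bounded_linear_on (completion S q) (completion_norm q) (completion_scale S q s) sZ T"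
  shows "bounded_linear_on S q s sZ (\<lambda>x. T (cls (\<lambda>_. x)))"
    and "onorm_on S q (\<lambda>x. T (cls (\<lambda>_. x))) \<le> onorm_on (completion S q) (completion_norm q) T"
proof -
  let ?C = "completion S q" and ?p = "completion_norm q"
  note cls = cls_in_completion
  have lin: "linear_map_on S s sZ (\<lambda>x. T (cls (\<lambda>_. x)))"
    unfolding linear_map_on_def
  proof (intro conjI ballI allI)
    fix x y assume xy: "x \<in> S" "y \<in> S"
    have "T (cls (\<lambda>_. x) + cls (\<lambda>_. y)) = T (cls (\<lambda>_. x)) + T (cls (\<lambda>_. y))"
      using T cls const_cauchy_seq xy unfolding bounded_linear_on_def linear_map_on_def by blast
    then show "T (cls (\<lambda>_. x + y)) = T (cls (\<lambda>_. x)) + T (cls (\<lambda>_. y))"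
      by (simp add: cls_add plus_fun_def)
  next
    fix c x assume x: "x \<in> S"
    have "T (completion_scale S q s c (cls (\<lambda>_. x))) = sZ c (T (cls (\<lambda>_. x)))"
      using T cls const_cauchy_seq x unfolding bounded_linear_on_def linear_map_on_def by blast
    then show "T (cls (\<lambda>_. s c x)) = sZ c (T (cls (\<lambda>_. x)))"
      by (simp add: completion_scale_cls)
  qed
  have ne: "?C \<noteq> {}" "S \<noteq> {}"
    using cls const_cauchy_seq in_S(1) by blast+
  have pos: "0 \<le> ?p A" if "A \<in> ?C" for A
    using that completion_norm_nonneg by (auto simp: completion_def)
  have bdd: "\<exists>K. \<forall>A\<in>?C. norm (T A) \<le> K * ?p A"
    using T by (simp add: bounded_linear_on_def)
  have le: "norm (T (cls (\<lambda>_. x))) \<le> onorm_on ?C ?p T * q x" if "x \<in> S" for x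
    using onorm_on_bound(1)[OF ne(1) pos bdd cls[OF const_cauchy_seq[OF that]]] that
    by (simp add: completion_norm_const)
  show "bounded_linear_on S q s sZ (\<lambda>x. T (cls (\<lambda>_. x)))"
    using lin le by (auto simp: bounded_linear_on_def)
  show "onorm_on S q (\<lambda>x. T (cls (\<lambda>_. x))) \<le> onorm_on ?C ?p T"
    using le onorm_on_bound(2)[OF ne(1) pos bdd] by (subst onorm_on_le_iff[OF ne(2) nonneg]) auto
qed

text \<open>
  The limit of \<open>T (u n)\<close> exists since the target is complete, and it depends only on the class of
  \<open>u\<close> because \<open>T\<close> maps null sequences to null sequences.
\<close>
lemma extension_to_completion:
  fixes sZ :: "'f \<Rightarrow> 'z::banach \<Rightarrow> 'z"
  assumes Z: "banach_space_over sZ" and T: "bounded_linear_on S q s sZ T"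
  obtains T' where
    "bounded_linear_on (completion S q) (completion_norm q) (completion_scale S q s) sZ T'"
    "\<And>u. u \<in> cauchy_seqs S q \<Longrightarrow> (\<lambda>n. T (u n)) \<longlonglongrightarrow> T' (cls u)"
    "onorm_on (completion S q) (completion_norm q) T' \<le> onorm_on S q T"
proof -
  interpret Z: banach_space_over sZ by fact
  let ?C = "completion S q" and ?p = "completion_norm q" and ?K = "onorm_on S q T"
  have add: "T (x + y) = T x + T y" and scale: "T (s c x) = sZ c (T x)"
    if "x \<in> S" "y \<in> S" for x y c
    using T that by (auto simp: bounded_linear_on_def linear_map_on_def)
  have diff: "T (x - y) = T x - T y" if "x \<in> S" "y \<in> S" for x y
    using add[OF in_S(3)[OF that] that(2)] by simp
  have S: "S \<noteq> {}" using in_S(1) by blast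
  have bdd: "\<exists>K. \<forall>x\<in>S. norm (T x) \<le> K * q x"
    using T by (simp add: bounded_linear_on_def)
  have K: "x \<in> S \<Longrightarrow> norm (T x) \<le> ?K * q x" "0 \<le> ?K" for x
    using onorm_on_bound[OF S nonneg bdd] by blast+
  have conv: "convergent (\<lambda>n. T (u n))" if u: "u \<in> cauchy_seqs S q" for u
  proof (intro Cauchy_convergent CauchyI)
    fix e :: real assume "e > 0"
    then have pos: "e / (?K + 1) > 0" using K(2) by simp
    obtain k where k: "\<And>m n. m \<ge> k \<Longrightarrow> n \<ge> k \<Longrightarrow> q (u m - u n) < e / (?K + 1)"
      using cauchy_seqsD[OF u pos] by blast
    have "norm (T (u m) - T (u n)) < e" if "m \<ge> k" "n \<ge> k" for m n
    proof -
      have S: "u m \<in> S" "u n \<in> S" "u m - u n \<in> S"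
        using cauchy_seqs_S[OF u] in_S by auto
      have "norm (T (u m) - T (u n)) \<le> ?K * q (u m - u n)"
        using K(1)[OF S(3)] by (simp add: diff S)
      also have "\<dots> \<le> (?K + 1) * q (u m - u n)"
        using nonneg[OF S(3)] by (simp add: mult_right_mono)
      also have "\<dots> < e"
        using k[OF that] K(2) by (simp add: pos_less_divide_eq mult.commute)
      finally show ?thesis .
    qed
    then show "\<exists>k. \<forall>m\<ge>k. \<forall>n\<ge>k. norm (T (u m) - T (u n)) < e" by blast
  qed
  \<comment> \<open>The choice of a representative is immaterial, by \<open>lim\<close> below.\<close>
  define T' where "T' A = lim (\<lambda>n. T ((SOME u. u \<in> cauchy_seqs S q \<and> A = cls u) n))" for A
  have lim: "(\<lambda>n. T (u n)) \<longlonglongrightarrow> T' (cls u)" if u: "u \<in> cauchy_seqs S q" for u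
  proof -
    let ?v = "SOME v. v \<in> cauchy_seqs S q \<and> cls u = cls v"
    have v: "?v \<in> cauchy_seqs S q \<and> cls u = cls ?v"
      by (rule someI[of _ u]) (simp add: u)
    then have n: "u - ?v \<in> null_seqs S q"
      using mem_cls[of u] mem_cls_iff[of u ?v] by simp
    have vS: "?v n \<in> S" and uS: "u n \<in> S" for n
      using v u cauchy_seqs_S by blast+
    have "(\<lambda>n. T (u n) - T (?v n)) \<longlonglongrightarrow> 0"
    proof (rule Lim_null_comparison)
      show "\<forall>\<^sub>F n in sequentially. norm (T (u n) - T (?v n)) \<le> ?K * q ((u - ?v) n)"
        using K(1)[OF null_seqs_S[OF n]] by (simp add: diff uS vS)
      show "(\<lambda>n. ?K * q ((u - ?v) n)) \<longlonglongrightarrow> 0"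
        by (rule tendsto_mult_right_zero[OF null_seqs_tendsto[OF n]])
    qed
    moreover have "(\<lambda>n. T (?v n)) \<longlonglongrightarrow> T' (cls u)"
      using conv v unfolding T'_def by (simp add: convergent_LIMSEQ_iff)
    ultimately show ?thesis
      using tendsto_add by fastforce
  qed
  have "T' (A + B) = T' A + T' B" if "A \<in> ?C" "B \<in> ?C" for A B
  proof -
    obtain u v where uv: "u \<in> cauchy_seqs S q" "v \<in> cauchy_seqs S q" "A = cls u" "B = cls v"
      using \<open>A \<in> ?C\<close> \<open>B \<in> ?C\<close> by (auto simp: completion_def)
    have "T' (cls (u + v)) = T' (cls u) + T' (cls v)"
    proof (rule LIMSEQ_unique)
      show "(\<lambda>n. T (u n) + T (v n)) \<longlonglongrightarrow> T' (cls (u + v))"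
        using lim[OF cauchy_seqs_add[OF uv(1,2)]]
        by (simp add: add cauchy_seqs_S[OF uv(1)] cauchy_seqs_S[OF uv(2)])
      show "(\<lambda>n. T (u n) + T (v n)) \<longlonglongrightarrow> T' (cls u) + T' (cls v)"
        using lim[OF uv(1)] lim[OF uv(2)] by (rule tendsto_add)
    qed
    then show ?thesis
      by (simp add: uv cls_add)
  qed
  moreover have "T' (completion_scale S q s c A) = sZ c (T' A)" if A: "A \<in> ?C" for c A
  proof -
    obtain u where u: "u \<in> cauchy_seqs S q" "A = cls u"
      using A by (auto simp: completion_def)
    have "(\<lambda>n. sZ c (T (u n))) \<longlonglongrightarrow> T' (cls (\<lambda>n. s c (u n)))"
      using lim[OF cauchy_seqs_scale[OF u(1), of c]]
      by (simp add: scale[OF cauchy_seqs_S[OF u(1)] in_S(1)])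
    moreover have "(\<lambda>n. sZ c (T (u n)) - sZ c (T' (cls u))) \<longlonglongrightarrow> 0"
    proof (rule Lim_null_comparison)
      show "\<forall>\<^sub>F n in sequentially.
          norm (sZ c (T (u n)) - sZ c (T' (cls u))) \<le> norm c * norm (T (u n) - T' (cls u))"
        by (simp add: Z.norm_scale flip: Z.scale_right_diff_distrib)
      show "(\<lambda>n. norm c * norm (T (u n) - T' (cls u))) \<longlonglongrightarrow> 0"
        using lim[OF u(1)] by (intro tendsto_mult_right_zero tendsto_norm_zero LIM_zero)
    qed
    ultimately have "T' (cls (\<lambda>n. s c (u n))) = sZ c (T' (cls u))"
      by (metis LIMSEQ_unique LIM_zero_cancel)
    then show ?thesis
      by (simp add: u(2) completion_scale_cls)
  qed
  ultimately have lin: "linear_map_on ?C (completion_scale S q s) sZ T'"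
    by (simp add: linear_map_on_def)
  have le: "norm (T' A) \<le> ?K * ?p A" if A: "A \<in> ?C" for A
  proof -
    obtain u where u: "u \<in> cauchy_seqs S q" "A = cls u"
      using A by (auto simp: completion_def)
    show ?thesis
      unfolding u(2)
      using tendsto_norm[OF lim[OF u(1)]] tendsto_mult_left[OF completion_norm_tendsto[OF u(1)], of ?K]
      by (rule LIMSEQ_le) (use K(1) cauchy_seqs_S[OF u(1)] in blast)
  qed
  show thesis
  proof (rule that[OF _ lim])
    show "bounded_linear_on ?C ?p (completion_scale S q s) sZ T'"
      using lin le by (auto simp: bounded_linear_on_def)
    have ne: "?C \<noteq> {}"
      using const_cauchy_seq in_S(1) by (auto simp: completion_def)
    have pos: "0 \<le> ?p A" if "A \<in> ?C" for A
      using that completion_norm_nonneg by (auto simp: completion_def)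
    have "\<exists>K. \<forall>A\<in>?C. norm (T' A) \<le> K * ?p A"
      using le by blast
    from onorm_on_le_iff[OF ne pos this, of ?K] show "onorm_on ?C ?p T' \<le> ?K"
      using le K(2) by blast
  qed
qed

end

text \<open>
  Extending operators from a smaller to a larger space with the same norm is equivalent to
  doing so for their completions.  In one direction an operator on the smaller completion is
  restricted to \<open>S'\<close>, extended to \<open>S\<close> and then to the larger completion; in the other, an operator
  on \<open>S'\<close> is passed to the smaller completion, extended, and restricted to \<open>S\<close>.  None of these steps
  increases the norm, and the result extends the given operator and hence cannot have a
  smaller norm, since \<open>p \<le> q\<close> on \<open>S'\<close>.  The inclusion of the completions may have a kernel, where
  \<open>p\<close> is too small; existence of extensions along it then says that all operators vanish there.
\<close>
lemma bounded_extension_completion_iff: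
  fixes s :: "'f::real_or_complex \<Rightarrow> 'v::ab_group_add \<Rightarrow> 'v" and sZ :: "'f \<Rightarrow> 'z::banach \<Rightarrow> 'z"
  assumes S: "seminormed_space s S p" and S': "seminormed_space s S' q"
    and sub: "S' \<subseteq> S" and le: "\<And>x. x \<in> S' \<Longrightarrow> p x \<le> q x" and Z: "banach_space_over sZ"
  shows "(\<forall>T. bounded_linear_on S' q s sZ T \<longrightarrow>
      (\<exists>T'. bounded_linear_on S p s sZ T' \<and> (\<forall>x\<in>S'. T' x = T x) \<and>
        onorm_on S p T' = onorm_on S' q T)) \<longleftrightarrow>
    (\<forall>T. bounded_linear_on (completion S' q) (completion_norm q) (completion_scale S' q s) sZ T \<longrightarrow>
      (\<exists>T'. bounded_linear_on (completion S p) (completion_norm p) (completion_scale S p s) sZ T' \<and>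
        (\<forall>A\<in>completion S' q. T' (completion_inclusion S p A) = T A) \<and>
        onorm_on (completion S p) (completion_norm p) T' =
        onorm_on (completion S' q) (completion_norm q) T))" (is "?dense \<longleftrightarrow> ?complete")
proof -
  interpret S: seminormed_space s S p by fact
  interpret S': seminormed_space s S' q by fact
  interpret Z: banach_space_over sZ by fact
  have null: "null_seqs S' q \<subseteq> null_seqs S p"
  proof
    fix u assume u: "u \<in> null_seqs S' q"
    then show "u \<in> null_seqs S p"
      using S'.null_seqs_S[OF u] sub le S'.null_seqs_tendsto[OF u]
      by (intro S.null_seqI[where v = "\<lambda>n. q (u n)"]) auto
  qed
  have cauchy: "cauchy_seqs S' q \<subseteq> cauchy_seqs S p"
  proof
    fix u assume u: "u \<in> cauchy_seqs S' q"
    have pq: "p (u m - u n) \<le> q (u m - u n)" for m n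
      by (intro le S'.in_S(3) S'.cauchy_seqs_S[OF u])
    show "u \<in> cauchy_seqs S p"
      unfolding cauchy_seqs_def
    proof (intro CollectI conjI allI impI)
      show "range u \<subseteq> S"
        using S'.cauchy_seqs_S[OF u] sub by blast
      fix e :: real assume e: "e > 0"
      obtain k where "\<And>m n. m \<ge> k \<Longrightarrow> n \<ge> k \<Longrightarrow> q (u m - u n) < e"
        using S'.cauchy_seqsD[OF u e] by blast
      then show "\<exists>k. \<forall>m\<ge>k. \<forall>n\<ge>k. p (u m - u n) < e"
        using pq by (meson le_less_trans)
    qed
  qed
  have incl: "completion_inclusion S p (S'.cls u) = S.cls u" for u
  proof -
    have "null_seqs S' q + null_seqs S p = null_seqs S p"
    proof
      show "null_seqs S' q + null_seqs S p \<subseteq> null_seqs S p"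
        using null S.null_seqs_plus set_plus_mono2[of "null_seqs S' q" "null_seqs S p"] by blast
      show "null_seqs S p \<subseteq> null_seqs S' q + null_seqs S p"
        using set_plus_intro[OF S'.zero_null_seq] by force
    qed
    then show ?thesis
      by (simp add: completion_inclusion_def set_plus_rearrange3)
  qed
  have ne: "S' \<noteq> {}" "S \<noteq> {}" "completion S' q \<noteq> {}" "completion S p \<noteq> {}"
    using S.in_S(1) S'.in_S(1) S.const_cauchy_seq S'.const_cauchy_seq
    by (auto simp: completion_def)
  have pos: "0 \<le> completion_norm p A" if "A \<in> completion S p" for A
    using that S.completion_norm_nonneg by (auto simp: completion_def)
  have pos': "0 \<le> completion_norm q A" if "A \<in> completion S' q" for A
    using that S'.completion_norm_nonneg by (auto simp: completion_def)
  show ?thesis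
  proof (intro iffI allI impI)
    fix T assume dense: ?dense
      and T: "bounded_linear_on (completion S' q) (completion_norm q) (completion_scale S' q s) sZ T"
    let ?T = "\<lambda>x. T (S'.cls (\<lambda>_. x))"
    obtain R where R: "bounded_linear_on S p s sZ R" "\<And>x. x \<in> S' \<Longrightarrow> R x = ?T x"
      "onorm_on S p R = onorm_on S' q ?T"
      using dense S'.restriction_from_completion(1)[OF T] by blast
    obtain T' where T': "bounded_linear_on (completion S p) (completion_norm p) (completion_scale S p s) sZ T'"
      "\<And>u. u \<in> cauchy_seqs S p \<Longrightarrow> (\<lambda>n. R (u n)) \<longlonglongrightarrow> T' (S.cls u)"
      "onorm_on (completion S p) (completion_norm p) T' \<le> onorm_on S p R"
      using S.extension_to_completion[OF Z R(1)] by blast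
    have ext: "T' (S.cls u) = T (S'.cls u)" if u: "u \<in> cauchy_seqs S' q" for u
    proof -
      have "(\<lambda>n. R (u n)) \<longlonglongrightarrow> T (S'.cls u)"
        using S'.bounded_linear_on_completion_tendsto[OF T u] R(2)[OF S'.cauchy_seqs_S[OF u]] by simp
      then show ?thesis
        using T'(2) u cauchy LIMSEQ_unique by blast
    qed
    have "onorm_on (completion S p) (completion_norm p) T' \<le>
        onorm_on (completion S' q) (completion_norm q) T"
      using T'(3) R(3) S'.restriction_from_completion(2)[OF T] by simp
    moreover have "onorm_on (completion S' q) (completion_norm q) T \<le>
        onorm_on (completion S p) (completion_norm p) T'" (is "_ \<le> ?K")
    proof -
      have bdd: "\<exists>K. \<forall>A\<in>completion S p. norm (T' A) \<le> K * completion_norm p A"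
        using T'(1) by (simp add: bounded_linear_on_def)
      have "norm (T (S'.cls u)) \<le> ?K * completion_norm q (S'.cls u)" if u: "u \<in> cauchy_seqs S' q" for u
      proof -
        have u': "u \<in> cauchy_seqs S p"
          using u cauchy by blast
        then have "norm (T (S'.cls u)) \<le> ?K * completion_norm p (S.cls u)"
          using onorm_on_bound(1)[OF ne(4) pos bdd] ext[OF u] by (force simp: completion_def)
        also have "completion_norm p (S.cls u) \<le> completion_norm q (S'.cls u)"
          using S.completion_norm_tendsto[OF u'] S'.completion_norm_tendsto[OF u]
          by (rule LIMSEQ_le) (use le S'.cauchy_seqs_S[OF u] in blast)
        finally show ?thesis
          using onorm_on_bound(2)[OF ne(4) pos bdd] by (simp add: mult_left_mono)
      qed
      then show ?thesis
        using onorm_on_bound(2)[OF ne(4) pos bdd] T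
        by (subst onorm_on_le_iff[OF ne(3) pos']) (auto simp: bounded_linear_on_def completion_def)
    qed
    ultimately show "\<exists>T'. bounded_linear_on (completion S p) (completion_norm p) (completion_scale S p s) sZ T' \<and>
        (\<forall>A\<in>completion S' q. T' (completion_inclusion S p A) = T A) \<and>
        onorm_on (completion S p) (completion_norm p) T' =
        onorm_on (completion S' q) (completion_norm q) T"
      using T'(1) ext by (intro exI[of _ T']) (auto simp: completion_def incl)
  next
    fix T assume complete: ?complete and T: "bounded_linear_on S' q s sZ T"
    obtain R where R: "bounded_linear_on (completion S' q) (completion_norm q) (completion_scale S' q s) sZ R"
      "\<And>u. u \<in> cauchy_seqs S' q \<Longrightarrow> (\<lambda>n. T (u n)) \<longlonglongrightarrow> R (S'.cls u)"
      "onorm_on (completion S' q) (completion_norm q) R \<le> onorm_on S' q T"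
      using S'.extension_to_completion[OF Z T] by blast
    obtain R' where R': "bounded_linear_on (completion S p) (completion_norm p) (completion_scale S p s) sZ R'"
      "\<And>A. A \<in> completion S' q \<Longrightarrow> R' (completion_inclusion S p A) = R A"
      "onorm_on (completion S p) (completion_norm p) R' =
       onorm_on (completion S' q) (completion_norm q) R"
      using complete R(1) by blast
    let ?T = "\<lambda>x. R' (S.cls (\<lambda>_. x))"
    note T' = S.restriction_from_completion[OF R'(1)]
    have ext: "?T x = T x" if "x \<in> S'" for x
    proof -
      have "R' (S.cls (\<lambda>_. x)) = R (S'.cls (\<lambda>_. x))"
        using R'(2)[of "S'.cls (\<lambda>_. x)"] S'.const_cauchy_seq[OF that] by (simp add: incl completion_def)
      also have "\<dots> = T x"
        using R(2)[OF S'.const_cauchy_seq[OF that]] by (simp add: LIMSEQ_const_iff)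
      finally show ?thesis .
    qed
    have "onorm_on S' q T \<le> onorm_on S p ?T"
    proof -
      have bdd: "\<exists>K. \<forall>x\<in>S. norm (?T x) \<le> K * p x"
        using T'(1) by (simp add: bounded_linear_on_def)
      have "norm (T x) \<le> onorm_on S p ?T * q x" if x: "x \<in> S'" for x
      proof -
        have "norm (T x) \<le> onorm_on S p ?T * p x"
          using onorm_on_bound(1)[OF ne(2) S.nonneg bdd] ext[OF x] x sub by force
        also have "\<dots> \<le> onorm_on S p ?T * q x"
          using onorm_on_bound(2)[OF ne(2) S.nonneg bdd] le[OF x] by (rule mult_left_mono[rotated])
        finally show ?thesis .
      qed
      then show ?thesis
        using onorm_on_bound(2)[OF ne(2) S.nonneg bdd] T
        by (subst onorm_on_le_iff[OF ne(1) S'.nonneg]) (auto simp: bounded_linear_on_def)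
    qed
    then have "onorm_on S p ?T = onorm_on S' q T"
      using T'(2) R'(3) R(3) by simp
    then show "\<exists>T'. bounded_linear_on S p s sZ T' \<and> (\<forall>x\<in>S'. T' x = T x) \<and>
        onorm_on S p T' = onorm_on S' q T"
      using T'(1) ext by (intro exI[of _ ?T]) simp
  qed
qed

section \<open>The assertions\<close>

context
  fixes sX :: "'f::real_or_complex \<Rightarrow> 'x::banach \<Rightarrow> 'x" and sY :: "'f \<Rightarrow> 'y::banach \<Rightarrow> 'y"
    and sZ :: "'f \<Rightarrow> 'z::banach \<Rightarrow> 'z" and M :: "'x set" and N :: "'y set"
  assumes X: "banach_space_over sX" and Y: "banach_space_over sY" and Z: "banach_space_over sZ"
    and M: "module.subspace sX M" and N: "module.subspace sY N"
    and M_ne: "\<exists>x\<in>M. x \<noteq> 0" and N_ne: "\<exists>y\<in>N. y \<noteq> 0"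
begin

interpretation X: banach_space_over sX by (fact X)
interpretation Y: banach_space_over sY by (fact Y)
interpretation Z: banach_space_over sZ by (fact Z)

lemma UNIV_facts:
  "module.subspace sX UNIV" "module.subspace sY UNIV" "\<exists>x\<in>UNIV. (x::'x) \<noteq> 0" "\<exists>y\<in>UNIV. (y::'y) \<noteq> 0"
  using M_ne N_ne by auto

lemma tensor_space_mono: "tensor_space sX sY M N \<subseteq> tensor_space sX sY UNIV UNIV"
proof -
  interpret vector_space "tensor_scale :: 'f \<Rightarrow> ('f, 'x, 'y) tensor \<Rightarrow> _"
    by (rule vector_space_tensor_scale)
  show ?thesis
    unfolding tensor_space_def by (rule span_mono) blast
qed

text \<open>
  There are more representations with entries in the larger spaces.
\<close>
lemma projective_norm_UNIV_le:
  assumes "F \<in> tensor_space sX sY M N"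
  shows "projective_norm sX sY UNIV UNIV F \<le> projective_norm sX sY M N F"
proof (rule projective_norm_greatest[OF X Y M N assms])
  fix r assume "representation sX sY M N F r"
  then have "representation sX sY UNIV UNIV F r"
    using representation_def[OF X Y M N] representation_def[OF X Y UNIV_facts(1,2)] by blast
  then show "projective_norm sX sY UNIV UNIV F \<le> r"
    by (rule projective_norm_le[OF X Y UNIV_facts(1,2)])
qed

text \<open>
  Precomposition with the two projections extends a bilinear map, and contractive projections
  do not increase its norm.
\<close>
lemma assertion_o_imp_b:
  assumes "assertion_o sX sY M N"
  shows "assertion_b sX sY sZ M N"
  unfolding assertion_b_def
proof (intro allI impI)
  fix \<phi> assume \<phi>: "bounded_bilinear_on M N sX sY sZ \<phi>"
  obtain E P where E: "Vector_Spaces.linear sX sX E" "bounded_linear E" "E \<circ> E = E" "M = range E" "onorm E = 1"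
    and P: "Vector_Spaces.linear sY sY P" "bounded_linear P" "P \<circ> P = P" "N = range P" "onorm P = 1"
    using assms by (auto simp: assertion_o_def bounded_projection_def)
  let ?\<phi> = "\<lambda>x y. \<phi> (E x) (P y)" and ?K = "bilinear_norm_on M N \<phi>"
  have E_id: "E x = x" if "x \<in> M" for x
    using that E(3,4) by (auto simp: fun_eq_iff)
  have P_id: "P y = y" if "y \<in> N" for y
    using that P(3,4) by (auto simp: fun_eq_iff)
  note iff = bilinear_norm_on_le_iff[OF \<phi> X.vector_space_axioms Y.vector_space_axioms
      Z.vector_space_axioms M_ne N_ne]
  have K: "0 \<le> ?K" "\<And>x y. x \<in> M \<Longrightarrow> y \<in> N \<Longrightarrow> norm (\<phi> x y) \<le> ?K * (norm x * norm y)"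
    using iff[of ?K] by auto
  have bil: "bilinear_on UNIV UNIV sX sY sZ ?\<phi>"
    using \<phi> E(1,4) P(1,4)
    by (auto simp: bounded_bilinear_on_def bilinear_on_def linear_map_on_def Vector_Spaces.linear_iff)
  have le: "norm (?\<phi> x y) \<le> ?K * (norm x * norm y)" for x y
  proof -
    have "norm (E x) * norm (P y) \<le> norm x * norm y"
      using onorm[OF E(2), of x] onorm[OF P(2), of y] E(5) P(5) by (intro mult_mono) auto
    then have "?K * (norm (E x) * norm (P y)) \<le> ?K * (norm x * norm y)"
      using K(1) by (rule mult_left_mono)
    then show ?thesis
      using K(2)[of "E x" "P y"] E(4) P(4) by force
  qed
  have \<phi>': "bounded_bilinear_on UNIV UNIV sX sY sZ ?\<phi>"
    using bil le by (auto simp: bounded_bilinear_on_def)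
  note iff' = bilinear_norm_on_le_iff[OF \<phi>' X.vector_space_axioms Y.vector_space_axioms
      Z.vector_space_axioms UNIV_facts(3,4)]
  have "bilinear_norm_on UNIV UNIV ?\<phi> \<le> ?K"
    using K(1) le by (simp add: iff')
  moreover have "?K \<le> bilinear_norm_on UNIV UNIV ?\<phi>"
    using iff'[of "bilinear_norm_on UNIV UNIV ?\<phi>"] by (simp add: iff) (metis E_id P_id)
  ultimately show "\<exists>\<phi>'. bounded_bilinear_on UNIV UNIV sX sY sZ \<phi>' \<and> (\<forall>x\<in>M. \<forall>y\<in>N. \<phi>' x y = \<phi> x y) \<and>
      bilinear_norm_on UNIV UNIV \<phi>' = ?K"
    using \<phi>' E_id P_id by (intro exI[of _ ?\<phi>]) auto
qed

text \<open>
  The difference of the two maps has the bound \<open>0\<close> on elementary tensors, hence everywhere.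
\<close>
lemma linear_map_on_tensor_space_eqI:
  assumes "linear_map_on (tensor_space sX sY M N) tensor_scale sZ T"
    and "linear_map_on (tensor_space sX sY M N) tensor_scale sZ T'"
    and "\<And>x y. x \<in> M \<Longrightarrow> y \<in> N \<Longrightarrow> T (tensor sX sY x y) = T' (tensor sX sY x y)"
    and F: "F \<in> tensor_space sX sY M N"
  shows "T F = T' F"
proof -
  let ?T = "\<lambda>F. T F - T' F"
  have lin: "linear_map_on (tensor_space sX sY M N) tensor_scale sZ ?T"
    using assms(1,2) by (simp add: linear_map_on_def Z.scale_right_diff_distrib)
  have "norm (?T F) \<le> 0 * projective_norm sX sY M N F"
    by (rule tensor_space_bound[OF X Y M N Z lin _ _ F]) (auto simp: assms(3))
  then show ?thesis by simp
qed

text \<open>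
  Linearisation turns an extension of bilinear maps into one of linear maps and conversely,
  without changing any norm.
\<close>
lemma assertion_b_iff_c: "assertion_b sX sY sZ M N \<longleftrightarrow> assertion_c sX sY sZ M N"
proof -
  let ?MN = "tensor_space sX sY M N" and ?XY = "tensor_space sX sY UNIV UNIV"
  note MN = bounded_linear_on_tensor_space_iff[OF X Y M N Z M_ne N_ne]
    and XY = bounded_linear_on_tensor_space_iff[OF X Y UNIV_facts(1,2) Z UNIV_facts(3,4)]
  note ex_MN = tensor_universal[OF X.vector_space_axioms Y.vector_space_axioms Z.vector_space_axioms M N]
    and ex_XY = tensor_universal[OF X.vector_space_axioms Y.vector_space_axioms Z.vector_space_axioms
      UNIV_facts(1,2)]
  show ?thesis
    unfolding assertion_b_def assertion_c_def Let_def
  proof (intro iffI allI impI)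
    fix T
    assume b: "\<forall>\<phi>. bounded_bilinear_on M N sX sY sZ \<phi> \<longrightarrow>
        (\<exists>\<phi>'. bounded_bilinear_on UNIV UNIV sX sY sZ \<phi>' \<and> (\<forall>x\<in>M. \<forall>y\<in>N. \<phi>' x y = \<phi> x y) \<and>
          bilinear_norm_on UNIV UNIV \<phi>' = bilinear_norm_on M N \<phi>)"
      and T: "bounded_linear_on ?MN (projective_norm sX sY M N) tensor_scale sZ T"
    let ?\<phi> = "\<lambda>x y. T (tensor sX sY x y)"
    have lin: "linear_map_on ?MN tensor_scale sZ T"
      using T by (simp add: bounded_linear_on_def)
    have \<phi>: "bounded_bilinear_on M N sX sY sZ ?\<phi>"
      using MN(1)[OF lin refl] T by simp
    obtain \<phi>' where \<phi>': "bounded_bilinear_on UNIV UNIV sX sY sZ \<phi>'"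
      "\<And>x y. x \<in> M \<Longrightarrow> y \<in> N \<Longrightarrow> \<phi>' x y = ?\<phi> x y" "bilinear_norm_on UNIV UNIV \<phi>' = bilinear_norm_on M N ?\<phi>"
      using b \<phi> by blast
    obtain T' where T': "linear_map_on ?XY tensor_scale sZ T'" "\<And>x y. T' (tensor sX sY x y) = \<phi>' x y"
      using ex_XY[of \<phi>'] \<phi>'(1) by (auto simp: bounded_bilinear_on_def)
    have lin': "linear_map_on ?MN tensor_scale sZ T'"
      using T'(1) tensor_space_mono by (auto simp: linear_map_on_def subset_iff)
    have "\<forall>F\<in>?MN. T' F = T F"
      using linear_map_on_tensor_space_eqI[OF lin' lin, unfolded T'(2), OF \<phi>'(2)] by blast
    moreover have "bounded_linear_on ?XY (projective_norm sX sY UNIV UNIV) tensor_scale sZ T'"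
      using XY(1)[OF T'] \<phi>'(1) by simp
    ultimately show "\<exists>T'. bounded_linear_on ?XY (projective_norm sX sY UNIV UNIV) tensor_scale sZ T' \<and>
        (\<forall>F\<in>?MN. T' F = T F) \<and> onorm_on ?XY (projective_norm sX sY UNIV UNIV) T' =
        onorm_on ?MN (projective_norm sX sY M N) T"
      using XY(2)[OF T' \<phi>'(1)] MN(2)[OF lin refl \<phi>] \<phi>'(3) by (intro exI[of _ T']) simp
  next
    fix \<phi>
    assume c: "\<forall>T. bounded_linear_on ?MN (projective_norm sX sY M N) tensor_scale sZ T \<longrightarrow>
        (\<exists>T'. bounded_linear_on ?XY (projective_norm sX sY UNIV UNIV) tensor_scale sZ T' \<and>
          (\<forall>F\<in>?MN. T' F = T F) \<and> onorm_on ?XY (projective_norm sX sY UNIV UNIV) T' =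
          onorm_on ?MN (projective_norm sX sY M N) T)"
      and \<phi>: "bounded_bilinear_on M N sX sY sZ \<phi>"
    obtain T where T: "linear_map_on ?MN tensor_scale sZ T"
      "\<And>x y. x \<in> M \<Longrightarrow> y \<in> N \<Longrightarrow> T (tensor sX sY x y) = \<phi> x y"
      using ex_MN[of \<phi>] \<phi> by (auto simp: bounded_bilinear_on_def)
    have "bounded_linear_on ?MN (projective_norm sX sY M N) tensor_scale sZ T"
      using MN(1)[OF T] \<phi> by simp
    then obtain T' where T': "bounded_linear_on ?XY (projective_norm sX sY UNIV UNIV) tensor_scale sZ T'"
      "\<And>F. F \<in> ?MN \<Longrightarrow> T' F = T F"
      "onorm_on ?XY (projective_norm sX sY UNIV UNIV) T' = onorm_on ?MN (projective_norm sX sY M N) T"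
      using c by blast
    let ?\<phi> = "\<lambda>x y. T' (tensor sX sY x y)"
    have lin: "linear_map_on ?XY tensor_scale sZ T'"
      using T'(1) by (simp add: bounded_linear_on_def)
    have \<phi>': "bounded_bilinear_on UNIV UNIV sX sY sZ ?\<phi>"
      using XY(1)[OF lin refl] T'(1) by simp
    show "\<exists>\<phi>'. bounded_bilinear_on UNIV UNIV sX sY sZ \<phi>' \<and> (\<forall>x\<in>M. \<forall>y\<in>N. \<phi>' x y = \<phi> x y) \<and>
        bilinear_norm_on UNIV UNIV \<phi>' = bilinear_norm_on M N \<phi>"
      using \<phi>' XY(2)[OF lin refl \<phi>'] MN(2)[OF T \<phi>] T'(2,3) T(2) tensor_in_tensor_space[OF X Y M N]
      by (intro exI[of _ ?\<phi>]) simp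
  qed
qed

text \<open>
  The operator \<open>F \<mapsto> f F z\<close>, with \<open>f\<close> a norming functional for \<open>G\<close> on \<open>M \<otimes> N\<close> and \<open>z\<close> a unit vector,
  has norm at most \<open>1\<close> with respect to the norm of \<open>M \<otimes> N\<close>.  Its extension to \<open>X \<otimes> Y\<close> has norm at
  most \<open>1\<close> as well and still maps \<open>G\<close> to a vector of norm \<open>\<parallel>G\<parallel>\<close>, which bounds the norm of \<open>G\<close> in
  \<open>X \<otimes> Y\<close> from below.
\<close>
lemma assertion_c_imp_a:
  assumes c: "assertion_c sX sY sZ M N" and z: "\<exists>z::'z. z \<noteq> 0"
  shows "assertion_a sX sY M N"
  unfolding assertion_a_def
proof
  let ?MN = "tensor_space sX sY M N" and ?XY = "tensor_space sX sY UNIV UNIV"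
  let ?q = "projective_norm sX sY M N" and ?p = "projective_norm sX sY UNIV UNIV"
  interpret q: seminormed_space tensor_scale ?MN ?q
    by (rule seminormed_space_projective_norm[OF X Y M N])
  interpret p: seminormed_space tensor_scale ?XY ?p
    by (rule seminormed_space_projective_norm[OF X Y UNIV_facts(1,2)])
  fix G assume G: "G \<in> ?MN"
  obtain f where f: "linear_map_on ?MN tensor_scale (*) f" "\<And>F. F \<in> ?MN \<Longrightarrow> norm (f F) \<le> ?q F"
    "norm (f G) = ?q G"
    using norming_functional[OF q.seminormed_space_axioms G] by blast
  obtain z0 :: 'z where "z0 \<noteq> 0" using z by blast
  then obtain z :: 'z where z: "norm z = 1"
    using norm_sgn[of z0] by auto
  let ?T = "\<lambda>F. sZ (f F) z"
  have T: "bounded_linear_on ?MN ?q tensor_scale sZ ?T"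
    unfolding bounded_linear_on_def
  proof (intro conjI exI[of _ 1] ballI)
    show "linear_map_on ?MN tensor_scale sZ ?T"
      using f(1) by (simp add: linear_map_on_def Z.scale_left_distrib)
  qed (use f(2) in \<open>simp add: Z.norm_scale z\<close>)
  then obtain T' where T': "bounded_linear_on ?XY ?p tensor_scale sZ T'" "\<And>F. F \<in> ?MN \<Longrightarrow> T' F = ?T F"
    "onorm_on ?XY ?p T' = onorm_on ?MN ?q ?T"
    using c unfolding assertion_c_def Let_def by blast
  have ne: "?MN \<noteq> {}" "?XY \<noteq> {}"
    using q.in_S(1) p.in_S(1) by blast+
  have "onorm_on ?MN ?q ?T \<le> 1"
    using T f(2) by (subst onorm_on_le_iff[OF ne(1) q.nonneg]) (auto simp: bounded_linear_on_def Z.norm_scale z)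
  moreover have GXY: "G \<in> ?XY"
    using G tensor_space_mono by blast
  moreover have "norm (T' G) \<le> onorm_on ?XY ?p T' * ?p G"
    using T'(1) GXY by (intro onorm_on_bound(1)[OF ne(2) p.nonneg]) (auto simp: bounded_linear_on_def)
  moreover have "norm (T' G) = ?q G"
    using T'(2)[OF G] f(3) by (simp add: Z.norm_scale z)
  ultimately have "?q G \<le> 1 * ?p G"
    using T'(3) p.nonneg[OF GXY] by (metis mult_right_mono order_trans)
  then show "?p G = ?q G"
    using projective_norm_UNIV_le[OF G] by simp
qed

lemma assertion_c_iff_d: "assertion_c sX sY sZ M N \<longleftrightarrow> assertion_d sX sY sZ M N"
  unfolding assertion_c_def assertion_d_def Let_def
  by (rule bounded_extension_completion_iff[OF
        seminormed_space_projective_norm[OF X Y UNIV_facts(1,2)]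
        seminormed_space_projective_norm[OF X Y M N]
        tensor_space_mono projective_norm_UNIV_le Z])

end

theorem corollary6p1:
  fixes sX :: "'f::real_or_complex \<Rightarrow> 'x::banach \<Rightarrow> 'x"
    and sY :: "'f \<Rightarrow> 'y::banach \<Rightarrow> 'y"
    and sZ :: "'f \<Rightarrow> 'z::banach \<Rightarrow> 'z"
    and M :: "'x set" and N :: "'y set"
  assumes "banach_space_over sX" and "banach_space_over sY" and "banach_space_over sZ"
    and "\<exists>x::'x. x \<noteq> 0" and "\<exists>y::'y. y \<noteq> 0" and "\<exists>z::'z. z \<noteq> 0"
    and "closed_subspace sX M" and "closed_subspace sY N"
    and "M \<noteq> {0}" and "N \<noteq> {0}"
  shows "(assertion_o sX sY M N \<longrightarrow> assertion_a sX sY M N \<and> assertion_b sX sY sZ M N) \<and>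
         (assertion_a sX sY M N \<and> assertion_b sX sY sZ M N \<longleftrightarrow> assertion_c sX sY sZ M N) \<and>
         (assertion_c sX sY sZ M N \<longleftrightarrow> assertion_d sX sY sZ M N)"
proof -
  interpret X: banach_space_over sX by fact
  interpret Y: banach_space_over sY by fact
  have M: "X.subspace M" and N: "Y.subspace N"
    using assms(7,8) by (auto simp: closed_subspace_def)
  have ne: "\<exists>x\<in>M. x \<noteq> 0" "\<exists>y\<in>N. y \<noteq> 0"
    using X.subspace_0[OF M] Y.subspace_0[OF N] assms(9,10) by blast+
  note ctxt = assms(1-3) M N ne
  show ?thesis
    using assertion_o_imp_b[OF ctxt] assertion_b_iff_c[OF ctxt] assertion_c_iff_d[OF ctxt]
      assertion_c_imp_a[OF ctxt _ assms(6)]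
    by blast
qed

end
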